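(* For every $\varepsilon\in(0,1)$ there is a randomized algorithm which, for maximizing a non-negative monotone submodular function $f$ on an $n$-element ground set subject to a knapsack constraint $c(T)\le B$, achieves a $(3+\varepsilon)$-approximation using $O(\frac{1}{\varepsilon}\log n)$ adaptive rounds and $O(\frac{n^2}{\varepsilon^3}\log^2 n\log\frac{1}{\varepsilon})$ value queries; and there is also such a $(3+\varepsilon)$-approximation algorithm using $O(\frac{1}{\varepsilon}\log^2 n)$ adaptive rounds and $O(\frac{n}{\varepsilon^3}\log^3 n\log\frac{1}{\varepsilon})$ value queries.
   Context: Problem setting: $\mathcal{N}$ is a finite ground set with $|\mathcal{N}|=n$; $f:2^{\mathcal{N}}\to\mathbb{R}$ is non-negative, monotone ($f(S)\le f(T)$ for $S\subseteq T$) and submodular ($f(S\cup\{x\})-f(S)\ge f(T\cup\{x\})-f(T)$ for $S\subseteq T$, $x\notin T$). A cost function $c:\mathcal{N}\to\mathbb{R}_{>0}$ is extended additively, $c(S)=\sum_{x\in S}c(x)$, and $B>0$ is a budget, with $\max_x c(x)\le B$ assumed throughout. Let $OPT=\max\{f(T): c(T)\le B\}$; a randomized algorithm is a $\beta$-approximation if $\beta\cdot\mathbb{E}[f(\text{output})]\ge OPT$ and its output always satisfies the constraint. The function $f$ is accessed only through a value oracle returning $f(S)$; query complexity is the total number of oracle calls, and adaptive complexity is the number of sequential rounds, where in each round polynomially many queries are issued in parallel and may depend only on answers from earlier rounds. *)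

theory Defs
  imports "HOL-Probability.Probability" "HOL-Library.Landau_Symbols"
begin

text \<open>
  A randomized algorithm with oracle access to a set function. One \<open>Round\<close> issues a whole batch
  of queries in parallel, and the continuation receives the answers in the order of the batch, so a
  query depends only on coin flips and on answers from earlier rounds. Computation between rounds is
  free, since only oracle calls and rounds are counted.
\<close>

datatype 'a oracle_alg =
    Return "'a set"
  | Round "'a set list" "real list \<Rightarrow> 'a oracle_alg"
  | Flip "'a oracle_alg pmf"

text \<open>
  The joint distribution of the output and the transcript. The transcript lists, round by round, the
  batches of queries that were issued.
\<close>

primrec run :: "('a set \<Rightarrow> real) \<Rightarrow> 'a oracle_alg \<Rightarrow> ('a set \<times> 'a set list list) pmf" where
  "run f (Return S) = return_pmf (S, [])"
| "run f (Round qs k) = map_pmf (\<lambda>(S, tr). (S, qs # tr)) (run f (k (map f qs)))"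
| "run f (Flip p) = join_pmf (map_pmf (run f) p)"

definition monotone_on_subsets :: "'a set \<Rightarrow> ('a set \<Rightarrow> real) \<Rightarrow> bool" where
  "monotone_on_subsets N f \<longleftrightarrow> (\<forall>S T. S \<subseteq> T \<and> T \<subseteq> N \<longrightarrow> f S \<le> f T)"

definition submodular_on_subsets :: "'a set \<Rightarrow> ('a set \<Rightarrow> real) \<Rightarrow> bool" where
  "submodular_on_subsets N f \<longleftrightarrow>
     (\<forall>S T x. S \<subseteq> T \<and> T \<subseteq> N \<and> x \<in> N - T \<longrightarrow>
        f (S \<union> {x}) - f S \<ge> f (T \<union> {x}) - f T)"

definition knapsack_instance ::
  "'a set \<Rightarrow> ('a \<Rightarrow> real) \<Rightarrow> real \<Rightarrow> ('a set \<Rightarrow> real) \<Rightarrow> bool" where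
  "knapsack_instance N c B f \<longleftrightarrow>
     finite N \<and> (\<forall>x\<in>N. 0 < c x) \<and> 0 < B \<and> (\<forall>x\<in>N. c x \<le> B) \<and>
     (\<forall>S\<subseteq>N. 0 \<le> f S) \<and> monotone_on_subsets N f \<and> submodular_on_subsets N f"

definition feasible :: "'a set \<Rightarrow> ('a \<Rightarrow> real) \<Rightarrow> real \<Rightarrow> 'a set \<Rightarrow> bool" where
  "feasible N c B T \<longleftrightarrow> T \<subseteq> N \<and> (\<Sum>x\<in>T. c x) \<le> B"

definition OPT :: "'a set \<Rightarrow> ('a \<Rightarrow> real) \<Rightarrow> real \<Rightarrow> ('a set \<Rightarrow> real) \<Rightarrow> real" where
  "OPT N c B f = Max (f ` {T. feasible N c B T})"

text \<open>
  A knapsack algorithm receives the ground set, the costs and the budget explicitly, and the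
  objective only through the oracle.
\<close>

type_synonym 'a knapsack_alg = "'a set \<Rightarrow> ('a \<Rightarrow> real) \<Rightarrow> real \<Rightarrow> 'a oracle_alg"

definition queries_subsets_only :: "'a knapsack_alg \<Rightarrow> bool" where
  "queries_subsets_only A \<longleftrightarrow>
     (\<forall>N c B f. knapsack_instance N c B f \<longrightarrow>
        (\<forall>(S, tr)\<in>set_pmf (run f (A N c B)). \<forall>qs\<in>set tr. \<forall>T\<in>set qs. T \<subseteq> N))"

definition approximation_alg :: "real \<Rightarrow> 'a knapsack_alg \<Rightarrow> bool" where
  "approximation_alg \<beta> A \<longleftrightarrow>
     (\<forall>N c B f. knapsack_instance N c B f \<longrightarrow>
        (\<forall>(S, tr)\<in>set_pmf (run f (A N c B)). feasible N c B S) \<and>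
        \<beta> * measure_pmf.expectation (run f (A N c B)) (\<lambda>(S, tr). f S) \<ge> OPT N c B f)"

text \<open>
  Both complexity bounds are worst-case: they hold for every instance and every outcome of the coin
  flips, as functions of the size of the ground set.

  Pitfall when stating such bounds uniformly in an accuracy parameter \<open>\<epsilon> \<in> (0,1)\<close>: a factor
  \<open>ln (1/\<epsilon>)\<close> vanishes as \<open>\<epsilon>\<close> tends to 1, so an \<open>O\<close>-bound containing it can only be uniform on
  each \<open>(0,\<delta>]\<close> with \<open>\<delta> < 1\<close>.
\<close>

definition adaptivity_bound :: "'a knapsack_alg \<Rightarrow> (nat \<Rightarrow> real) \<Rightarrow> bool" where
  "adaptivity_bound A r \<longleftrightarrow>
     (\<forall>N c B f. knapsack_instance N c B f \<longrightarrow>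
        (\<forall>(S, tr)\<in>set_pmf (run f (A N c B)). real (length tr) \<le> r (card N)))"

definition query_bound :: "'a knapsack_alg \<Rightarrow> (nat \<Rightarrow> real) \<Rightarrow> bool" where
  "query_bound A q \<longleftrightarrow>
     (\<forall>N c B f. knapsack_instance N c B f \<longrightarrow>
        (\<forall>(S, tr)\<in>set_pmf (run f (A N c B)). real (length (concat tr)) \<le> q (card N)))"

end

theory Submission
  imports Defs
begin

text \<open>
  One algorithm meets both pairs of bounds. Guess \<open>v \<approx> OPT\<close> up to a factor \<open>1 + \<eta>\<close>, where \<open>\<eta> = \<epsilon> / 24\<close>,
  trying all guesses in parallel, and add elements of marginal density at least \<open>\<theta> = (2/3) v / B\<close>
  until none is left or the budget overflows. In the first case the solution misses at most
  \<open>\<theta> B \<le> (2/3) OPT\<close>. In the second it is worth about \<open>\<theta> B\<close>, and the solution without its last element,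
  or that element alone, has half of this value.

  To add many elements in one round, read the set \<open>X\<close> of remaining elements in random order and take
  the shortest prefix after which the elements still of density \<open>\<theta>\<close> have cost at most \<open>(1 - \<eta>) c(X)\<close>.
  Before that point the next element, being uniform among the unread ones, costs in expectation at
  most \<open>\<eta>\<close> times as much on bad elements as in total, so the loss of density is small in expectation;
  and \<open>c(X)\<close> decreases geometrically whatever the coins are, so the number of rounds is bounded in
  the worst case. Elements of cost below \<open>\<eta> B / n\<close> are taken for free, which bounds the ratio of
  costs. Only prefixes at which the accumulated cost crosses a power of \<open>1 + \<eta>\<close> are tested, which
  needs \<open>O(n ln n / \<eta>)\<close> queries per guess and round and rounds the stopping position up at a relative
  cost of \<open>\<eta>\<close>.
\<close>

section \<open>Expectations over finite distributions\<close>

lemma expectation_bind_finite: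
  fixes h :: "'b \<Rightarrow> real"
  assumes "finite (set_pmf p)" "\<And>x. x \<in> set_pmf p \<Longrightarrow> finite (set_pmf (q x))"
  shows "measure_pmf.expectation (p \<bind> q) h =
    measure_pmf.expectation p (\<lambda>x. measure_pmf.expectation (q x) h)"
proof -
  have "measure_pmf.expectation (p \<bind> q) h =
      (\<Sum>a\<in>set_pmf p. pmf p a *\<^sub>R measure_pmf.expectation (q a) h)"
    using assms by (intro pmf_expectation_bind) auto
  also have "\<dots> = measure_pmf.expectation p (\<lambda>x. measure_pmf.expectation (q x) h)"
    using assms by (subst integral_measure_pmf[of "set_pmf p"]) auto
  finally show ?thesis .
qed

lemma expectation_mono_finite:
  fixes g h :: "'b \<Rightarrow> real"
  assumes "finite (set_pmf p)" "\<And>x. x \<in> set_pmf p \<Longrightarrow> g x \<le> h x"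
  shows "measure_pmf.expectation p g \<le> measure_pmf.expectation p h"
  using assms
  by (intro integral_mono_AE integrable_measure_pmf_finite) (auto simp: AE_measure_pmf_iff)

lemma length_concat_map_le:
  assumes "\<And>x. x \<in> set xs \<Longrightarrow> length (h x) \<le> m"
  shows "length (concat (map h xs)) \<le> length xs * m"
  using assms by (induction xs) (auto simp: add_mono)

subsection \<open>Geometric grids\<close>

text \<open>Level 0 is reserved for the value 0, which lies on no multiplicative scale. Values of at
  least \<open>a\<close> are classed by the integer part of their logarithm, counted from level
  1.\<close>

definition level :: "real \<Rightarrow> real \<Rightarrow> real \<Rightarrow> nat" where
  "level \<eta> a r = (if r = 0 then 0 else Suc (nat \<lfloor>log (1 + \<eta>) (r / a)\<rfloor>))"

text \<open>
  The last position of each level: rounding a position up to the grid increases \<open>C\<close> by a factor of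
  at most \<open>1 + \<eta>\<close>, and there are only logarithmically many levels.
\<close>

definition grid :: "real \<Rightarrow> real \<Rightarrow> (nat \<Rightarrow> real) \<Rightarrow> nat \<Rightarrow> nat set" where
  "grid \<eta> a C n = {t. t \<le> n \<and> (t < n \<longrightarrow> level \<eta> a (C (Suc t)) \<noteq> level \<eta> a (C t))}"

lemma finite_grid [simp]: "finite (grid \<eta> a C n)"
  by (rule finite_subset[of _ "{..n}"]) (auto simp: grid_def)

lemma level_mono:
  assumes "0 < \<eta>" "0 < a" "r = 0 \<or> a \<le> r" "r \<le> s"
  shows "level \<eta> a r \<le> level \<eta> a s"
proof (cases "r = 0")
  case False
  hence "0 < r" "0 < s" using assms by auto
  hence "log (1 + \<eta>) (r / a) \<le> log (1 + \<eta>) (s / a)"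
    using assms by (simp add: divide_right_mono)
  hence "\<lfloor>log (1 + \<eta>) (r / a)\<rfloor> \<le> \<lfloor>log (1 + \<eta>) (s / a)\<rfloor>" by (rule floor_mono)
  thus ?thesis using \<open>0 < r\<close> \<open>0 < s\<close> by (simp add: level_def nat_mono)
qed (simp add: level_def)

text \<open>Equal integer parts put the two logarithms less than 1 apart, hence the values within a
  factor \<open>1 + \<eta>\<close>. The logarithms are nonnegative as both values are at least
  \<open>a\<close>, so \<open>nat\<close> identifies nothing; level 0 contains only the value
  0.\<close>

lemma level_eq_imp_le:
  assumes "0 < \<eta>" "0 < a" "r = 0 \<or> a \<le> r" "s = 0 \<or> a \<le> s" "level \<eta> a r = level \<eta> a s"
  shows "s \<le> (1 + \<eta>) * r"
proof (cases "r = 0 \<or> s = 0")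
  case True
  thus ?thesis using assms by (auto simp: level_def split: if_splits)
next
  case False
  hence rs: "a \<le> r" "a \<le> s" using assms by auto
  have pos: "0 \<le> log (1 + \<eta>) (r / a)" "0 \<le> log (1 + \<eta>) (s / a)"
    using rs assms by auto
  have "nat \<lfloor>log (1 + \<eta>) (r / a)\<rfloor> = nat \<lfloor>log (1 + \<eta>) (s / a)\<rfloor>"
    using assms False by (simp add: level_def)
  hence eq: "\<lfloor>log (1 + \<eta>) (r / a)\<rfloor> = \<lfloor>log (1 + \<eta>) (s / a)\<rfloor>"
    using pos by (simp add: eq_nat_nat_iff)
  hence "log (1 + \<eta>) (s / a) \<le> log (1 + \<eta>) (r / a) + 1"
    by linarith
  also have "\<dots> = log (1 + \<eta>) ((r / a) * (1 + \<eta>))"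
    using rs assms by (subst log_mult) auto
  finally have "s / a \<le> (r / a) * (1 + \<eta>)"
    using rs assms by (subst (asm) log_le_cancel_iff) auto
  thus ?thesis using assms by (simp add: field_simps)
qed

text \<open>The witness is the last position on the level of \<open>i\<close>: its successor, if
  there is one, is on another level, which puts it on the grid.\<close>

lemma grid_covers:
  assumes "0 < \<eta>" "0 < a" "\<And>i. i \<le> n \<Longrightarrow> C i = 0 \<or> a \<le> C i" "i \<le> n"
  shows "\<exists>t\<in>grid \<eta> a C n. i \<le> t \<and> C t \<le> (1 + \<eta>) * C i"
proof -
  define T where "T = {t. t \<le> n \<and> level \<eta> a (C t) = level \<eta> a (C i)}"
  have fin: "finite T" and mem: "i \<in> T" using assms unfolding T_def by auto
  have max: "Max T \<in> T" using fin mem by (intro Max_in) auto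
  have "Suc (Max T) \<notin> T" using fin Max_ge[of T "Suc (Max T)"] not_less_eq_eq by blast
  hence "Max T \<in> grid \<eta> a C n" using max unfolding T_def grid_def by auto
  moreover have "i \<le> Max T" using fin mem by simp
  moreover have "C (Max T) \<le> (1 + \<eta>) * C i"
    using max assms unfolding T_def by (intro level_eq_imp_le[of \<eta> a]) auto
  ultimately show ?thesis by blast
qed

lemma card_grid_le_length: "card (grid \<eta> a C n) \<le> Suc n"
  using card_mono[of "{..n}" "grid \<eta> a C n"] by (auto simp: grid_def)

text \<open>For monotone \<open>C\<close> a level never returns once it is left, so each level
  contributes at most one grid position. The \<open>Suc\<close> counts level 0.\<close>

lemma card_grid_le_level:
  assumes "0 < \<eta>" "0 < a" "\<And>i. i \<le> n \<Longrightarrow> C i = 0 \<or> a \<le> C i"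
    and mono: "\<And>i j. i \<le> j \<Longrightarrow> j \<le> n \<Longrightarrow> C i \<le> C j" and "C n \<le> b"
  shows "card (grid \<eta> a C n) \<le> Suc (level \<eta> a b)"
proof -
  let ?l = "\<lambda>t. level \<eta> a (C t)"
  have lm: "?l i \<le> ?l j" if "i \<le> j" "j \<le> n" for i j
    using assms that by (intro level_mono) auto
  have "inj_on ?l (grid \<eta> a C n)"
  proof (rule linorder_inj_onI)
    fix s t assume st: "s < t" "s \<in> grid \<eta> a C n" "t \<in> grid \<eta> a C n"
    hence "?l s < ?l (Suc s)" using lm[of s "Suc s"] by (auto simp: grid_def)
    also have "\<dots> \<le> ?l t" using st by (intro lm) (auto simp: grid_def)
    finally show "?l s \<noteq> ?l t" by simp
  qed auto
  moreover have "?l ` grid \<eta> a C n \<subseteq> {..level \<eta> a b}"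
    using assms by (auto simp: grid_def intro!: level_mono order_trans[OF mono[of _ n]])
  ultimately have "card (grid \<eta> a C n) \<le> card {..level \<eta> a b}"
    by (metis card_image card_mono finite_atMost)
  thus ?thesis by simp
qed

subsection \<open>Reading a random permutation\<close>

text \<open>The list will be a permutation of the whole ground set, so that one permutation serves
  the sets \<open>X\<close> of all guesses; elements outside \<open>X\<close> are skipped. Recursion
  on the list lets expectations be computed by conditioning on its first element.\<close>

primrec collect :: "('a set \<Rightarrow> bool) \<Rightarrow> 'a set \<Rightarrow> 'a set \<Rightarrow> 'a list \<Rightarrow> 'a set" where
  "collect halt X Y [] = Y"
| "collect halt X Y (x # xs) =
     (if halt Y then Y else collect halt X (if x \<in> X then insert x Y else Y) xs)"

text \<open>The weight sees the set \<open>Y\<close> read before \<open>x\<close>, because whether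
  \<open>x\<close> is bad depends on the solution at the moment of reading.\<close>

primrec charge ::
  "('a set \<Rightarrow> bool) \<Rightarrow> ('a set \<Rightarrow> 'a \<Rightarrow> real) \<Rightarrow> 'a set \<Rightarrow> 'a set \<Rightarrow> 'a list \<Rightarrow> real" where
  "charge halt w X Y [] = 0"
| "charge halt w X Y (x # xs) =
     (if halt Y then 0
      else if x \<in> X then w Y x + charge halt w X (insert x Y) xs else charge halt w X Y xs)"

definition picked :: "'a set \<Rightarrow> 'a list \<Rightarrow> nat \<Rightarrow> 'a set" where
  "picked X xs i = X \<inter> set (take i xs)"

lemma picked_mono: "i \<le> j \<Longrightarrow> picked X xs i \<subseteq> picked X xs j"
  unfolding picked_def using set_take_subset_set_take by fastforce

text \<open>Translates the recursive reading, which suits induction over random permutations, into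
  positions, which the algorithm uses: \<open>i\<close> is the first halting prefix, or the whole
  list.\<close>

lemma collect_eq_picked:
  "\<exists>i\<le>length xs. collect halt X Y xs = Y \<union> picked X xs i \<and>
     (\<forall>j<i. \<not> halt (Y \<union> picked X xs j)) \<and> (i = length xs \<or> halt (Y \<union> picked X xs i))"
proof (induction xs arbitrary: Y)
  case Nil
  thus ?case by (simp add: picked_def)
next
  case (Cons x xs)
  show ?case
  proof (cases "halt Y")
    case True
    thus ?thesis by (intro exI[of _ 0]) (simp add: picked_def)
  next
    case False
    define Z where "Z = (if x \<in> X then insert x Y else Y)"
    have eq: "Z \<union> picked X xs j = Y \<union> picked X (x # xs) (Suc j)" for j
      by (auto simp: Z_def picked_def)
    obtain i where i: "i \<le> length xs" "collect halt X Z xs = Z \<union> picked X xs i"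
      "\<And>j. j < i \<Longrightarrow> \<not> halt (Z \<union> picked X xs j)" "i = length xs \<or> halt (Z \<union> picked X xs i)"
      using Cons.IH[of Z] by blast
    have "\<not> halt (Y \<union> picked X (x # xs) j)" if "j < Suc i" for j
      using that i(3) False unfolding eq by (cases j) (auto simp: picked_def)
    moreover have "collect halt X Y (x # xs) = Y \<union> picked X (x # xs) (Suc i)"
      using False i(2) unfolding eq by (simp add: Z_def)
    ultimately show ?thesis
      using i unfolding eq by (intro exI[of _ "Suc i"]) auto
  qed
qed

lemma sum_collect:
  assumes "finite Y" "distinct xs" "Y \<inter> set xs = {}"
  shows "sum c (collect halt X Y xs) = sum c Y + charge halt (\<lambda>_ x. c x) X Y xs"
  using assms
proof (induction xs arbitrary: Y)
  case (Cons x xs)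
  have "sum c (collect halt X (insert x Y) xs) =
      sum c (insert x Y) + charge halt (\<lambda>_ x. c x) X (insert x Y) xs"
    using Cons.prems by (intro Cons.IH) auto
  moreover have "sum c (collect halt X Y xs) = sum c Y + charge halt (\<lambda>_ x. c x) X Y xs"
    using Cons.prems by (intro Cons.IH) auto
  ultimately show ?case using Cons.prems by auto
qed auto

lemma charge_linear:
  "charge halt (\<lambda>Y x. u * v Y x - w Y x) X Y xs = u * charge halt v X Y xs - charge halt w X Y xs"
  by (induction xs arbitrary: Y) (auto simp: algebra_simps)

lemma charge_nonneg:
  assumes "\<And>Y x. x \<in> X \<Longrightarrow> 0 \<le> w Y x"
  shows "0 \<le> charge halt w X Y xs"
  using assms by (induction xs arbitrary: Y) auto

text \<open>
  Given the prefix read so far, the next element is uniform on the unread part \<open>R\<close> of the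
  permutation, so a nonnegative sum over \<open>R\<close> is a nonnegative conditional expectation.
\<close>

lemma expectation_charge_nonneg:
  assumes "finite R" "X \<subseteq> Y \<union> R" "Y \<inter> R = {}" "Y \<subseteq> X"
    and drift: "\<And>Y R. finite R \<Longrightarrow> X \<subseteq> Y \<union> R \<Longrightarrow> Y \<inter> R = {} \<Longrightarrow> Y \<subseteq> X \<Longrightarrow> \<not> halt Y \<Longrightarrow>
      0 \<le> (\<Sum>x\<in>R \<inter> X. w Y x)"
  shows "0 \<le> measure_pmf.expectation (pmf_of_set (permutations_of_set R)) (charge halt w X Y)"
  using assms(1-4)
proof (induction "card R" arbitrary: R Y)
  case 0
  thus ?case by (simp add: pmf_of_set_singleton)
next
  case (Suc m)
  let ?E = "\<lambda>R h. measure_pmf.expectation (pmf_of_set (permutations_of_set R)) h :: real"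
  have ne: "R \<noteq> {}" using Suc by auto
  have fin: "finite (set_pmf (pmf_of_set (permutations_of_set (R - {x}))))" for x
    using Suc.prems by (subst set_pmf_of_set) auto
  have integ: "integrable (measure_pmf (pmf_of_set (permutations_of_set (R - {x})))) (h :: _ \<Rightarrow> real)"
    for x h using fin by (rule integrable_measure_pmf_finite)
  show ?case
  proof (cases "halt Y")
    case True
    have "charge halt w X Y = (\<lambda>_. 0)"
    proof
      fix xs show "charge halt w X Y xs = 0" using True by (cases xs) auto
    qed
    thus ?thesis by simp
  next
    case False
    \<comment> \<open>The first element is uniform on \<open>R\<close>, and the rest is a uniform
      permutation of \<open>R - {x}\<close>.\<close>
    have "?E R (charge halt w X Y) =
        (\<Sum>x\<in>R. ?E (R - {x}) (\<lambda>xs. charge halt w X Y (x # xs))) / card R"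
      unfolding random_permutation_of_set[OF Suc.prems(1) ne]
      using Suc.prems(1) ne fin
      by (simp add: expectation_bind_finite integral_pmf_of_set map_pmf_def[symmetric])
    also have "(\<Sum>x\<in>R. ?E (R - {x}) (\<lambda>xs. charge halt w X Y (x # xs))) =
        (\<Sum>x\<in>R. (if x \<in> X then w Y x else 0) +
          ?E (R - {x}) (charge halt w X (if x \<in> X then insert x Y else Y)))"
      using False integ by (intro sum.cong) auto
    also have "\<dots> = (\<Sum>x\<in>R \<inter> X. w Y x) +
        (\<Sum>x\<in>R. ?E (R - {x}) (charge halt w X (if x \<in> X then insert x Y else Y)))"
      using Suc.prems(1) by (simp add: sum.distrib sum.inter_restrict)
    finally have eq: "?E R (charge halt w X Y) = \<dots> / card R" .
    have "0 \<le> ?E (R - {x}) (charge halt w X (if x \<in> X then insert x Y else Y))" if "x \<in> R" for x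
      using Suc.hyps(2) Suc.prems that by (intro Suc.hyps(1)) auto
    hence "0 \<le> (\<Sum>x\<in>R. ?E (R - {x}) (charge halt w X (if x \<in> X then insert x Y else Y)))"
      by (intro sum_nonneg) auto
    moreover have "0 \<le> (\<Sum>x\<in>R \<inter> X. w Y x)"
      using Suc.prems False by (intro drift) auto
    ultimately show ?thesis unfolding eq by simp
  qed
qed

subsection \<open>One round of threshold sampling\<close>

definition cheap_elements :: "real \<Rightarrow> 'a set \<Rightarrow> ('a \<Rightarrow> real) \<Rightarrow> real \<Rightarrow> 'a set" where
  "cheap_elements \<eta> N c B = {x \<in> N. c x < \<eta> * B / card N}"

definition good :: "('a \<Rightarrow> real) \<Rightarrow> real \<Rightarrow> ('a set \<Rightarrow> real) \<Rightarrow> 'a set \<Rightarrow> 'a set \<Rightarrow> 'a set" where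
  "good c \<theta> g S X = {x \<in> X - S. \<theta> * c x \<le> g (insert x S) - g S}"

definition dropped ::
  "real \<Rightarrow> ('a \<Rightarrow> real) \<Rightarrow> real \<Rightarrow> ('a set \<Rightarrow> real) \<Rightarrow> 'a set \<Rightarrow> 'a set \<Rightarrow> 'a set \<Rightarrow> bool" where
  "dropped \<eta> c \<theta> g A X Y \<longleftrightarrow> sum c (good c \<theta> g (A \<union> Y) X) \<le> (1 - \<eta>) * sum c X"

text \<open>As \<open>length \<pi>\<close> is the size of the ground set, the unit of the grid is
  the cost from which on an element is no longer cheap.\<close>

definition probes :: "real \<Rightarrow> ('a \<Rightarrow> real) \<Rightarrow> real \<Rightarrow> 'a set \<Rightarrow> 'a list \<Rightarrow> nat set" where
  "probes \<eta> c B X \<pi> =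
     grid \<eta> (\<eta> * B / length \<pi>) (\<lambda>i. sum c (picked X \<pi> i)) (length \<pi>)"

text \<open>Only probes are inspected, since marginals are queried only there. The minimum exists
  because the last probe covers all of \<open>X\<close>, after which no element is left to be
  good.\<close>

definition cut ::
  "real \<Rightarrow> ('a \<Rightarrow> real) \<Rightarrow> real \<Rightarrow> ('a set \<Rightarrow> real) \<Rightarrow> real \<Rightarrow> 'a set \<Rightarrow> 'a set \<Rightarrow> 'a list \<Rightarrow> nat" where
  "cut \<eta> c B g \<theta> A X \<pi> = (LEAST t. t \<in> probes \<eta> c B X \<pi> \<and> dropped \<eta> c \<theta> g A X (picked X \<pi> t))"

text \<open>Overflow is a matter of costs alone, so it is detected without queries at its exact
  position and not at the next probe. Hence an overfull solution becomes feasible when its last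
  element is removed.\<close>

definition halting_position ::
  "real \<Rightarrow> ('a \<Rightarrow> real) \<Rightarrow> real \<Rightarrow> ('a set \<Rightarrow> real) \<Rightarrow> real \<Rightarrow> 'a set \<Rightarrow> 'a set \<Rightarrow> 'a list \<Rightarrow> nat" where
  "halting_position \<eta> c B g \<theta> A X \<pi> =
     (LEAST u. u = cut \<eta> c B g \<theta> A X \<pi> \<or> B < sum c (A \<union> picked X \<pi> u))"

text \<open>
  A state \<open>(\<theta>, A, X)\<close> holds the density threshold, the current solution and the elements that may
  still be added. An overfull solution is recorded by \<open>B < sum c A\<close> and \<open>X = {}\<close>; it is then a
  fixed point.
\<close>

type_synonym 'a state = "real \<times> 'a set \<times> 'a set"

fun step ::
  "real \<Rightarrow> ('a \<Rightarrow> real) \<Rightarrow> real \<Rightarrow> ('a set \<Rightarrow> real) \<Rightarrow> 'a list \<Rightarrow> 'a state \<Rightarrow> 'a state" where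
  "step \<eta> c B g \<pi> (\<theta>, A, X) =
     (let A' = A \<union> picked X \<pi> (halting_position \<eta> c B g \<theta> A X \<pi>)
      in (\<theta>, A', if B < sum c A' then {} else good c \<theta> g A' X))"

fun step_queries :: "real \<Rightarrow> ('a \<Rightarrow> real) \<Rightarrow> real \<Rightarrow> 'a list \<Rightarrow> 'a state \<Rightarrow> 'a set list" where
  "step_queries \<eta> c B \<pi> (\<theta>, A, X) =
     concat (map (\<lambda>t. (A \<union> picked X \<pi> t) # map (\<lambda>x. insert x (A \<union> picked X \<pi> t)) \<pi>)
       (sorted_list_of_set (probes \<eta> c B X \<pi>)))"

text \<open>
  An upper bound for the cost that \<open>step\<close> adds without earning density \<open>\<theta>\<close>: the bad elements read
  before the first halting position, plus the cost of rounding that position up to the grid.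
\<close>

fun step_loss :: "real \<Rightarrow> ('a \<Rightarrow> real) \<Rightarrow> real \<Rightarrow> ('a set \<Rightarrow> real) \<Rightarrow> 'a list \<Rightarrow> 'a state \<Rightarrow> real" where
  "step_loss \<eta> c B g \<pi> (\<theta>, A, X) =
     (let halt = (\<lambda>Y. B < sum c (A \<union> Y) \<or> dropped \<eta> c \<theta> g A X Y)
      in charge halt (\<lambda>Y x. if x \<in> good c \<theta> g (A \<union> Y) X then 0 else c x) X {} \<pi>
         + \<eta> * charge halt (\<lambda>_ x. c x) X {} \<pi>)"

section \<open>Monotone submodular functions on a set with costs\<close>

locale knapsack =
  fixes N :: "'a set" and c :: "'a \<Rightarrow> real" and B :: real and f :: "'a set \<Rightarrow> real"
  assumes inst: "knapsack_instance N c B f"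
begin

lemma fin: "finite N" and cost_pos: "x \<in> N \<Longrightarrow> 0 < c x" and budget_pos: "0 < B"
  and cost_le: "x \<in> N \<Longrightarrow> c x \<le> B" and nonneg: "S \<subseteq> N \<Longrightarrow> 0 \<le> f S"
  and mono: "S \<subseteq> T \<Longrightarrow> T \<subseteq> N \<Longrightarrow> f S \<le> f T"
  using inst by (auto simp: knapsack_instance_def monotone_on_subsets_def)

lemma diminishing:
  assumes "S \<subseteq> T" "T \<subseteq> N" "x \<in> N" "x \<notin> T"
  shows "f (insert x T) - f T \<le> f (insert x S) - f S"
  using inst assms by (auto simp: knapsack_instance_def submodular_on_subsets_def)

lemma finite_subset_N: "S \<subseteq> N \<Longrightarrow> finite S"
  using fin finite_subset by blast

lemma cost_mono: "S \<subseteq> T \<Longrightarrow> T \<subseteq> N \<Longrightarrow> sum c S \<le> sum c T"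
  using finite_subset_N by (intro sum_mono2) (auto intro!: less_imp_le[OF cost_pos])

lemma cost_nonneg: "S \<subseteq> N \<Longrightarrow> 0 \<le> sum c S"
  by (intro sum_nonneg) (auto intro!: less_imp_le[OF cost_pos])

lemma gain_le_sum_marginals:
  assumes "S \<subseteq> N" "T \<subseteq> N" "S \<inter> T = {}"
  shows "f (S \<union> T) - f S \<le> (\<Sum>x\<in>T. f (insert x S) - f S)"
proof -
  have "finite T" using assms finite_subset_N by blast
  thus ?thesis using assms
  proof (induction T rule: finite_induct)
    case (insert x T)
    have "f (insert x (S \<union> T)) - f (S \<union> T) \<le> f (insert x S) - f S"
      using insert by (intro diminishing) auto
    thus ?case using insert by auto
  qed auto
qed

text \<open>Serves to bound the optimum by values of singletons and to split an overfull solution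
  into its last element and the rest.\<close>

lemma subadditive_singleton:
  assumes "S \<subseteq> N" "a \<in> N"
  shows "f (insert a S) \<le> f S + f {a}"
proof (cases "a \<in> S")
  case True
  thus ?thesis using nonneg[of "{a}"] assms by (simp add: insert_absorb)
next
  case False
  have "f (insert a S) - f S \<le> f {a} - f {}"
    using diminishing[of "{}" S a] assms False by auto
  thus ?thesis using nonneg[of "{}"] by simp
qed

lemma good_antimono:
  assumes "S \<subseteq> T" "T \<subseteq> N" "X \<subseteq> N"
  shows "good c \<theta> f T X \<subseteq> good c \<theta> f S X"
  using assms diminishing[of S T] by (fastforce simp: good_def)

lemma good_subset: "good c \<theta> g S X \<subseteq> X"
  by (auto simp: good_def)

text \<open>An element that is good when it is read raises the value by at least
  \<open>\<theta> * c x\<close>; a bad one does not lower it, by monotonicity.\<close>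

lemma value_collect:
  assumes "A \<union> X \<subseteq> N" "A \<inter> X = {}" "Y \<subseteq> X" "distinct xs" "Y \<inter> set xs = {}"
  shows "f (A \<union> Y) + \<theta> * (charge halt (\<lambda>_ x. c x) X Y xs
      - charge halt (\<lambda>Y x. if x \<in> good c \<theta> f (A \<union> Y) X then 0 else c x) X Y xs)
    \<le> f (A \<union> collect halt X Y xs)"
  using assms(3-)
proof (induction xs arbitrary: Y)
  case (Cons x xs)
  let ?c = "\<lambda>Y. charge halt (\<lambda>_ x. c x) X Y xs"
  let ?b = "\<lambda>Y. charge halt (\<lambda>Y x. if x \<in> good c \<theta> f (A \<union> Y) X then 0 else c x) X Y xs"
  show ?case
  proof (cases "halt Y \<or> x \<notin> X")
    case True
    thus ?thesis using Cons by auto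
  next
    case False
    have IH: "f (A \<union> insert x Y) + \<theta> * (?c (insert x Y) - ?b (insert x Y))
        \<le> f (A \<union> collect halt X (insert x Y) xs)"
      using Cons.prems False by (intro Cons.IH) auto
    have "f (A \<union> Y) + \<theta> * (c x - (if x \<in> good c \<theta> f (A \<union> Y) X then 0 else c x))
        \<le> f (A \<union> insert x Y)"
      using Cons.prems False assms(1) mono[of "A \<union> Y" "insert x (A \<union> Y)"] by (auto simp: good_def)
    thus ?thesis using IH False by (simp add: algebra_simps)
  qed
qed auto

end

section \<open>One round on a well-formed state\<close>

locale threshold_search = knapsack +
  fixes \<eta> :: real
  assumes eta: "0 < \<eta>" "\<eta> < 1" and N_nonempty: "N \<noteq> {}"
begin

abbreviation "unit \<equiv> \<eta> * B / card N"

abbreviation "cheap \<equiv> cheap_elements \<eta> N c B"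

lemmas cheap_def = cheap_elements_def

lemma card_pos: "0 < card N"
  using N_nonempty fin by (simp add: card_gt_0_iff)

lemma unit_pos: "0 < unit"
  using card_pos eta budget_pos by simp

lemma cost_cheap: "sum c cheap \<le> \<eta> * B"
proof -
  have "sum c cheap \<le> (\<Sum>x\<in>cheap. unit)"
    by (intro sum_mono) (auto simp: cheap_def)
  also have "\<dots> \<le> (\<Sum>x\<in>N. unit)"
    using unit_pos fin by (intro sum_mono2) (auto simp: cheap_def)
  finally show ?thesis using card_pos by simp
qed

text \<open>The first alternative bounds what the optimum can still add once \<open>X\<close> is
  empty; the second yields the two candidates of an overfull solution. As \<open>A\<close> contains
  the cheap elements and is disjoint from \<open>X\<close>, each element of \<open>X\<close> costs
  at least \<open>unit\<close>.\<close>

definition wf_state :: "'a state \<Rightarrow> bool" where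
  "wf_state s \<longleftrightarrow> (case s of (\<theta>, A, X) \<Rightarrow>
     cheap \<subseteq> A \<and> A \<subseteq> N \<and> X \<subseteq> N \<and> A \<inter> X = {} \<and>
     (sum c A \<le> B \<and> (\<forall>x\<in>N - A - X. f (insert x A) - f A \<le> \<theta> * c x) \<or>
      B < sum c A \<and> X = {} \<and> (\<exists>a\<in>A. sum c (A - {a}) \<le> B)))"

context
  fixes \<theta> A X \<pi>
  assumes wf: "wf_state (\<theta>, A, X)" and perm: "\<pi> \<in> permutations_of_set N"
begin

lemma perm_facts: "set \<pi> = N" "distinct \<pi>" "length \<pi> = card N"
  using perm by (auto simp: permutations_of_set_def distinct_card)

lemma state_subsets: "cheap \<subseteq> A" "A \<subseteq> N" "X \<subseteq> N" "A \<inter> X = {}"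
  using wf by (auto simp: wf_state_def)

lemma picked_subset: "picked X \<pi> i \<subseteq> X"
  by (auto simp: picked_def)

lemma picked_all: "picked X \<pi> (card N) = X"
  using perm_facts state_subsets by (auto simp: picked_def)

lemma picked_cost: "sum c (picked X \<pi> i) = 0 \<or> unit \<le> sum c (picked X \<pi> i)"
proof (cases "picked X \<pi> i = {}")
  case False
  then obtain x where x: "x \<in> picked X \<pi> i" by auto
  hence "x \<in> X" using picked_subset by auto
  hence "unit \<le> c x" using state_subsets by (force simp: cheap_def)
  also have "\<dots> = sum c {x}" by simp
  also have "\<dots> \<le> sum c (picked X \<pi> i)"
    using x picked_subset[of i] state_subsets by (intro cost_mono) auto
  finally show ?thesis by simp
qed auto

lemma picked_cost_mono: "i \<le> j \<Longrightarrow> sum c (picked X \<pi> i) \<le> sum c (picked X \<pi> j)"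
  using picked_mono[of i j X \<pi>] picked_subset[of j] state_subsets by (intro cost_mono) auto

text \<open>By submodularity good elements can only become bad as the solution grows, so rounding a
  position up to a probe keeps the drop.\<close>

lemma dropped_mono:
  assumes "Y \<subseteq> Z" "Z \<subseteq> X" "dropped \<eta> c \<theta> f A X Y"
  shows "dropped \<eta> c \<theta> f A X Z"
proof -
  have "sum c (good c \<theta> f (A \<union> Z) X) \<le> sum c (good c \<theta> f (A \<union> Y) X)"
    using assms state_subsets good_subset[of \<theta> f "A \<union> Y" X]
    by (intro cost_mono good_antimono) auto
  thus ?thesis using assms by (simp add: dropped_def)
qed

lemma dropped_all: "dropped \<eta> c \<theta> g A X X"
proof -
  have "good c \<theta> g (A \<union> X) X = {}" by (auto simp: good_def)
  thus ?thesis using eta cost_nonneg[OF state_subsets(3)] by (simp add: dropped_def)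
qed

lemma probe_above:
  assumes "i \<le> card N"
  shows "\<exists>t\<in>probes \<eta> c B X \<pi>. i \<le> t \<and> sum c (picked X \<pi> t) \<le> (1 + \<eta>) * sum c (picked X \<pi> i)"
  unfolding probes_def perm_facts
  using eta unit_pos assms picked_cost by (intro grid_covers) auto

lemma card_N_in_probes: "card N \<in> probes \<eta> c B X \<pi>"
  using probe_above[of "card N"] by (auto simp: probes_def perm_facts grid_def)

lemma cut_in_probes: "cut \<eta> c B g \<theta> A X \<pi> \<in> probes \<eta> c B X \<pi>"
  and cut_dropped: "dropped \<eta> c \<theta> g A X (picked X \<pi> (cut \<eta> c B g \<theta> A X \<pi>))"
  unfolding cut_def
  using LeastI[of "\<lambda>t. t \<in> probes \<eta> c B X \<pi> \<and> dropped \<eta> c \<theta> g A X (picked X \<pi> t)" "card N"]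
    card_N_in_probes dropped_all picked_all by auto

lemma cut_le:
  "t \<in> probes \<eta> c B X \<pi> \<Longrightarrow> dropped \<eta> c \<theta> g A X (picked X \<pi> t) \<Longrightarrow> cut \<eta> c B g \<theta> A X \<pi> \<le> t"
  unfolding cut_def by (rule Least_le) auto

lemma halting_position_cases:
  "halting_position \<eta> c B g \<theta> A X \<pi> = cut \<eta> c B g \<theta> A X \<pi> \<or>
   B < sum c (A \<union> picked X \<pi> (halting_position \<eta> c B g \<theta> A X \<pi>))"
  unfolding halting_position_def by (rule LeastI[of _ "cut \<eta> c B g \<theta> A X \<pi>"]) auto

lemma halting_position_le_cut: "halting_position \<eta> c B g \<theta> A X \<pi> \<le> cut \<eta> c B g \<theta> A X \<pi>"
  unfolding halting_position_def by (rule Least_le) auto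

lemma halting_position_le:
  "B < sum c (A \<union> picked X \<pi> u) \<Longrightarrow> halting_position \<eta> c B g \<theta> A X \<pi> \<le> u"
  unfolding halting_position_def by (rule Least_le) auto

text \<open>A step needs the oracle at probes only. If the halting position differs from the cut,
  the solution is overfull and \<open>X\<close> is emptied without looking at marginals; otherwise
  it is the cut, itself a probe.\<close>

lemma step_cong:
  assumes "\<And>T. T \<in> set (step_queries \<eta> c B \<pi> (\<theta>, A, X)) \<Longrightarrow> g T = f T"
  shows "step \<eta> c B g \<pi> (\<theta>, A, X) = step \<eta> c B f \<pi> (\<theta>, A, X)"
proof -
  have fin_probes: "finite (probes \<eta> c B X \<pi>)" by (simp add: probes_def)
  have good_eq: "good c \<theta> g (A \<union> picked X \<pi> t) X = good c \<theta> f (A \<union> picked X \<pi> t) X"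
    if "t \<in> probes \<eta> c B X \<pi>" for t
  proof -
    have "g (A \<union> picked X \<pi> t) = f (A \<union> picked X \<pi> t)"
      using that fin_probes by (intro assms) auto
    moreover have "g (insert x (A \<union> picked X \<pi> t)) = f (insert x (A \<union> picked X \<pi> t))"
      if "x \<in> X" for x
      using that \<open>t \<in> _\<close> fin_probes state_subsets(3) perm_facts(1)
      by (intro assms) (auto intro!: bexI[of _ t])
    ultimately show ?thesis by (auto simp: good_def)
  qed
  have cut_eq: "cut \<eta> c B g \<theta> A X \<pi> = cut \<eta> c B f \<theta> A X \<pi>"
    unfolding cut_def dropped_def using good_eq by (intro arg_cong[of _ _ Least]) auto
  hence pos_eq: "halting_position \<eta> c B g \<theta> A X \<pi> = halting_position \<eta> c B f \<theta> A X \<pi>"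
    by (simp add: halting_position_def)
  show ?thesis
  proof (cases "B < sum c (A \<union> picked X \<pi> (halting_position \<eta> c B f \<theta> A X \<pi>))")
    case False
    hence "halting_position \<eta> c B f \<theta> A X \<pi> = cut \<eta> c B f \<theta> A X \<pi>"
      using halting_position_cases by blast
    thus ?thesis using good_eq[OF cut_in_probes[of f]] pos_eq by (simp add: Let_def)
  qed (simp add: pos_eq Let_def)
qed

lemma wf_step: "wf_state (step \<eta> c B f \<pi> (\<theta>, A, X))"
proof -
  let ?u = "halting_position \<eta> c B f \<theta> A X \<pi>"
  define A' where "A' = A \<union> picked X \<pi> ?u"
  have sub: "cheap \<subseteq> A'" "A' \<subseteq> N" "good c \<theta> f A' X \<subseteq> N" "A' \<inter> good c \<theta> f A' X = {}"
    using state_subsets picked_subset[of ?u] by (auto simp: A'_def good_def)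
  have eq: "step \<eta> c B f \<pi> (\<theta>, A, X) = (\<theta>, A', if B < sum c A' then {} else good c \<theta> f A' X)"
    by (simp add: A'_def Let_def)
  show ?thesis
  proof (cases "B < sum c A'")
    case True
    have "\<exists>a\<in>A'. sum c (A' - {a}) \<le> B"
    proof (cases "B < sum c A")
      case True
      \<comment> \<open>An overfull state has nothing left to read and does not change.\<close>
      hence "X = {}" "\<exists>a\<in>A. sum c (A - {a}) \<le> B" using wf by (auto simp: wf_state_def)
      thus ?thesis by (simp add: A'_def picked_def)
    next
      case False
      have "?u \<noteq> 0"
      proof
        assume "?u = 0"
        hence "A' = A" by (simp add: A'_def picked_def)
        thus False using \<open>B < sum c A'\<close> False by simp
      qed
      \<comment> \<open>By minimality the budget still holds at the preceding position
        \<open>v\<close>, so the element read there causes the overflow.\<close>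
      then obtain v where v: "?u = Suc v" using not0_implies_Suc by blast
      have le: "sum c (A \<union> picked X \<pi> v) \<le> B"
        using halting_position_le[of v f] v by force
      have "v < length \<pi>"
      proof (rule ccontr)
        assume "\<not> v < length \<pi>"
        hence "picked X \<pi> ?u = picked X \<pi> v" unfolding v picked_def by simp
        thus False using le \<open>B < sum c A'\<close> by (simp add: A'_def)
      qed
      hence "A' \<subseteq> insert (\<pi> ! v) (A \<union> picked X \<pi> v)"
        by (auto simp: A'_def v picked_def take_Suc_conv_app_nth)
      hence sub': "A' - {\<pi> ! v} \<subseteq> A \<union> picked X \<pi> v" by auto
      hence "sum c (A' - {\<pi> ! v}) \<le> sum c (A \<union> picked X \<pi> v)"
        using state_subsets picked_subset[of v] by (intro cost_mono) auto
      hence le': "sum c (A' - {\<pi> ! v}) \<le> B" using le by simp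
      \<comment> \<open>Otherwise removing it would leave the overfull \<open>A'\<close>
        unchanged.\<close>
      moreover have "\<pi> ! v \<in> A'"
        using le' True by (metis Diff_empty Diff_insert0 not_less)
      ultimately show ?thesis by blast
    qed
    thus ?thesis using True sub unfolding eq by (auto simp: wf_state_def)
  next
    case False
    have "sum c A \<le> sum c A'" using sub by (intro cost_mono) (auto simp: A'_def)
    hence "sum c A \<le> B" using False by simp
    hence marg: "f (insert x A) - f A \<le> \<theta> * c x" if "x \<in> N - A - X" for x
      using wf that by (auto simp: wf_state_def)
    have "f (insert x A') - f A' \<le> \<theta> * c x" if x: "x \<in> N - A' - good c \<theta> f A' X" for x
    proof (cases "x \<in> X")
      case True
      thus ?thesis using x by (auto simp: good_def)
    next
      case False
      \<comment> \<open>Elements discarded earlier stay below the threshold by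
        submodularity.\<close>
      have "f (insert x A') - f A' \<le> f (insert x A) - f A"
        using x sub by (intro diminishing) (auto simp: A'_def)
      thus ?thesis using marg[of x] x False by (auto simp: A'_def)
    qed
    thus ?thesis using False sub unfolding eq by (auto simp: wf_state_def)
  qed
qed

text \<open>The bounds hold for every permutation, which makes the round count a worst-case one. The
  last inclusion is strict because \<open>sum c X\<close> is positive and shrinks by a factor below
  1.\<close>

lemma step_progress:
  assumes "step \<eta> c B f \<pi> (\<theta>, A, X) = (\<theta>', A', X')"
  shows "\<theta>' = \<theta>" "A \<subseteq> A'" "X' \<subseteq> X" "sum c X' \<le> (1 - \<eta>) * sum c X" "X \<noteq> {} \<Longrightarrow> X' \<subset> X"
proof -
  show eq: "\<theta>' = \<theta>" "A \<subseteq> A'" and sub: "X' \<subseteq> X"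
    using assms by (auto simp: Let_def good_def split: if_splits)
  show drop: "sum c X' \<le> (1 - \<eta>) * sum c X"
  proof (cases "B < sum c A'")
    case True
    thus ?thesis using assms eta cost_nonneg[OF state_subsets(3)] by (auto simp: Let_def)
  next
    case False
    hence "halting_position \<eta> c B f \<theta> A X \<pi> = cut \<eta> c B f \<theta> A X \<pi>"
      using halting_position_cases[of f] assms by (auto simp: Let_def)
    thus ?thesis using cut_dropped[of f] False assms by (auto simp: Let_def dropped_def)
  qed
  assume "X \<noteq> {}"
  hence "0 < sum c X"
    using state_subsets cost_pos finite_subset_N by (intro sum_pos) auto
  hence "(1 - \<eta>) * sum c X < 1 * sum c X" using eta by (intro mult_strict_right_mono) auto
  hence "sum c X' < sum c X" using drop by simp
  thus "X' \<subset> X" using sub by auto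
qed

lemma step_loss_nonneg: "0 \<le> step_loss \<eta> c B g \<pi> (\<theta>, A, X)"
  using eta state_subsets unfolding step_loss.simps Let_def
  by (intro add_nonneg_nonneg mult_nonneg_nonneg charge_nonneg)
     (auto intro!: less_imp_le[OF cost_pos])

text \<open>Up to the first halting position \<open>i\<close>, \<open>value_collect\<close> accounts
  for the gain. From there to the actual position only monotonicity is used; that stretch costs at
  most \<eta> times the cost up to \<open>i\<close>, which is the second term of
  \<open>step_loss\<close>.\<close>

lemma step_gain:
  assumes "step \<eta> c B f \<pi> (\<theta>, A, X) = (\<theta>', A', X')" "0 \<le> \<theta>"
  defines "halt \<equiv> \<lambda>Y. B < sum c (A \<union> Y) \<or> dropped \<eta> c \<theta> f A X Y"
  shows "charge halt (\<lambda>_ x. c x) X {} \<pi> \<le> sum c A' - sum c A" (is "?cc \<le> _")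
    and "f A + \<theta> * (sum c A' - sum c A - step_loss \<eta> c B f \<pi> (\<theta>, A, X)) \<le> f A'"
proof -
  let ?u = "halting_position \<eta> c B f \<theta> A X \<pi>"
  let ?b = "charge halt (\<lambda>Y x. if x \<in> good c \<theta> f (A \<union> Y) X then 0 else c x) X {} \<pi>"
  have A': "A' = A \<union> picked X \<pi> ?u" using assms(1) by (auto simp: Let_def)
  have cA': "sum c A' = sum c A + sum c (picked X \<pi> ?u)"
    unfolding A' using state_subsets finite_subset_N picked_subset[of ?u]
    by (intro sum.union_disjoint) auto
  obtain i where i: "i \<le> length \<pi>" "collect halt X {} \<pi> = {} \<union> picked X \<pi> i"
    "\<forall>j<i. \<not> halt ({} \<union> picked X \<pi> j)" "i = length \<pi> \<or> halt ({} \<union> picked X \<pi> i)"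
    using collect_eq_picked by blast
  have halt_i: "halt (picked X \<pi> i)"
    using i(4) picked_all dropped_all by (auto simp: perm_facts halt_def)
  have "halt (picked X \<pi> ?u)"
    using halting_position_cases[of f] cut_dropped[of f] unfolding halt_def by auto
  hence "i \<le> ?u" using i(3) by (metis not_less sup_bot_left)
  hence sub: "picked X \<pi> i \<subseteq> picked X \<pi> ?u" by (rule picked_mono)
  have cc: "?cc = sum c (picked X \<pi> i)"
    using sum_collect[of "{}" \<pi> c halt X] perm_facts i(2) by simp
  show "?cc \<le> sum c A' - sum c A"
    unfolding cc cA' using picked_cost_mono[OF \<open>i \<le> ?u\<close>] by simp
  \<comment> \<open>If the budget overflows at \<open>i\<close>, the step stops exactly there.
    Otherwise the good elements have dropped at \<open>i\<close>, hence also at the probe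
    \<open>t\<close> above it, so the actual position is at most \<open>t\<close>.\<close>
  have up: "sum c (picked X \<pi> ?u) \<le> (1 + \<eta>) * sum c (picked X \<pi> i)"
  proof (cases "B < sum c (A \<union> picked X \<pi> i)")
    case True
    hence "?u = i" using halting_position_le[of i f] \<open>i \<le> ?u\<close> by simp
    moreover have "0 \<le> sum c (picked X \<pi> i)"
      using picked_subset state_subsets by (intro cost_nonneg) blast
    ultimately show ?thesis using eta by (simp add: algebra_simps)
  next
    case False
    hence drop: "dropped \<eta> c \<theta> f A X (picked X \<pi> i)" using halt_i by (simp add: halt_def)
    obtain t where t: "t \<in> probes \<eta> c B X \<pi>" "i \<le> t"
      "sum c (picked X \<pi> t) \<le> (1 + \<eta>) * sum c (picked X \<pi> i)"
      using probe_above i(1) perm_facts by metis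
    have "dropped \<eta> c \<theta> f A X (picked X \<pi> t)"
      by (rule dropped_mono[OF picked_mono[OF t(2)] picked_subset drop])
    hence "?u \<le> t" using cut_le[OF t(1), of f] halting_position_le_cut[of f] by simp
    thus ?thesis using picked_cost_mono[of ?u t] t by linarith
  qed
  have "f A + \<theta> * (?cc - ?b) \<le> f (A \<union> picked X \<pi> i)"
    using value_collect[of A X "{}" \<pi> \<theta> halt] state_subsets perm_facts i(2) by simp
  also have "\<dots> \<le> f A'"
    unfolding A' using sub picked_subset[of ?u] state_subsets by (intro mono) auto
  finally have "f A + \<theta> * (?cc - ?b) \<le> f A'" .
  moreover have "\<theta> * (sum c A' - sum c A - step_loss \<eta> c B f \<pi> (\<theta>, A, X)) \<le> \<theta> * (?cc - ?b)"
    using up assms(2) unfolding cA' cc[symmetric]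
    by (intro mult_left_mono) (simp_all add: Let_def halt_def algebra_simps)
  ultimately show "f A + \<theta> * (sum c A' - sum c A - step_loss \<eta> c B f \<pi> (\<theta>, A, X)) \<le> f A'"
    by simp
qed

end

text \<open>The factor 2 is one \<eta> for the bad elements, by the drift of
  \<open>\<eta> * c x - bad Y x\<close>, and one for rounding up to a probe.\<close>

lemma expectation_step_loss:
  assumes "wf_state (\<theta>, A, X)" "0 \<le> \<theta>"
  shows "measure_pmf.expectation (pmf_of_set (permutations_of_set N))
      (\<lambda>\<pi>. step_loss \<eta> c B f \<pi> (\<theta>, A, X)) \<le>
    measure_pmf.expectation (pmf_of_set (permutations_of_set N))
      (\<lambda>\<pi>. 2 * \<eta> * (sum c (fst (snd (step \<eta> c B f \<pi> (\<theta>, A, X)))) - sum c A))"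
proof -
  let ?E = "measure_pmf.expectation (pmf_of_set (permutations_of_set N)) :: _ \<Rightarrow> real"
  define halt where "halt = (\<lambda>Y. B < sum c (A \<union> Y) \<or> dropped \<eta> c \<theta> f A X Y)"
  define bad where "bad = (\<lambda>Y x. if x \<in> good c \<theta> f (A \<union> Y) X then 0 else c x)"
  let ?cc = "charge halt (\<lambda>_ x. c x) X {}" and ?b = "charge halt bad X {}"
  have set_perm: "set_pmf (pmf_of_set (permutations_of_set N)) = permutations_of_set N"
    using fin by (intro set_pmf_of_set) auto
  hence finp: "finite (set_pmf (pmf_of_set (permutations_of_set N)))" by simp
  have integ: "integrable (measure_pmf (pmf_of_set (permutations_of_set N))) (h :: _ \<Rightarrow> real)" for h
    using finp by (rule integrable_measure_pmf_finite)
  have sub: "A \<subseteq> N" "X \<subseteq> N" "A \<inter> X = {}" using assms by (auto simp: wf_state_def)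
  have "0 \<le> ?E (charge halt (\<lambda>Y x. \<eta> * c x - bad Y x) X {})"
  proof (rule expectation_charge_nonneg)
    fix Y R :: "'a set"
    assume R: "finite R" "X \<subseteq> Y \<union> R" "Y \<inter> R = {}" "Y \<subseteq> X" "\<not> halt Y"
    let ?G = "good c \<theta> f (A \<union> Y) X"
    have G: "?G \<subseteq> R \<inter> X" using R by (auto simp: good_def)
    have "(\<Sum>x\<in>R \<inter> X. \<eta> * c x - bad Y x) = (\<Sum>x\<in>R \<inter> X. (\<eta> - 1) * c x + (if x \<in> ?G then c x else 0))"
      by (intro sum.cong) (auto simp: bad_def algebra_simps)
    also have "\<dots> = (\<eta> - 1) * sum c (R \<inter> X) + sum c (R \<inter> X \<inter> ?G)"
      using R(1) sum.inter_restrict[of "R \<inter> X" c ?G] by (simp add: sum.distrib sum_distrib_left)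
    also have "R \<inter> X \<inter> ?G = ?G" using G by auto
    finally have eq: "(\<Sum>x\<in>R \<inter> X. \<eta> * c x - bad Y x) = (\<eta> - 1) * sum c (R \<inter> X) + sum c ?G" .
    \<comment> \<open>Before halting the good elements, all of them unread, cost more than this, so
      the bad ones make up less than an \<eta> fraction of the unread cost.\<close>
    have "(1 - \<eta>) * sum c (R \<inter> X) \<le> (1 - \<eta>) * sum c X"
      using eta sub by (intro mult_left_mono cost_mono) auto
    also have "\<dots> < sum c ?G" using R(5) by (simp add: halt_def dropped_def)
    finally show "0 \<le> (\<Sum>x\<in>R \<inter> X. \<eta> * c x - bad Y x)" unfolding eq by (simp add: algebra_simps)
  qed (use fin sub in auto)
  hence b: "?E ?b \<le> \<eta> * ?E ?cc"
    using integ by (simp add: charge_linear[abs_def])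
  have "?E (\<lambda>\<pi>. step_loss \<eta> c B f \<pi> (\<theta>, A, X)) = ?E ?b + \<eta> * ?E ?cc"
    using integ by (simp add: Let_def halt_def bad_def)
  also have "\<dots> \<le> ?E (\<lambda>\<pi>. 2 * \<eta> * ?cc \<pi>)" using b by simp
  also have "\<dots> \<le> ?E (\<lambda>\<pi>. 2 * \<eta> * (sum c (fst (snd (step \<eta> c B f \<pi> (\<theta>, A, X)))) - sum c A))"
  proof (rule expectation_mono_finite[OF finp], unfold set_perm)
    fix \<pi> assume "\<pi> \<in> permutations_of_set N"
    moreover obtain \<theta>' A' X' where s: "step \<eta> c B f \<pi> (\<theta>, A, X) = (\<theta>', A', X')"
      by (cases "step \<eta> c B f \<pi> (\<theta>, A, X)")
    ultimately have "?cc \<pi> \<le> sum c A' - sum c A"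
      unfolding halt_def using assms by (intro step_gain(1)) auto
    thus "2 * \<eta> * ?cc \<pi> \<le> 2 * \<eta> * (sum c (fst (snd (step \<eta> c B f \<pi> (\<theta>, A, X)))) - sum c A)"
      using s eta by (simp add: mult_left_mono)
  qed
  finally show ?thesis .
qed

end

subsection \<open>The parallel algorithm\<close>

text \<open>
  The answers are passed on as a partial copy of the oracle; off \<open>set qs\<close> it has junk values.
\<close>

definition ask :: "'a set list \<Rightarrow> (('a set \<Rightarrow> real) \<Rightarrow> 'a oracle_alg) \<Rightarrow> 'a oracle_alg" where
  "ask qs k = Round qs (\<lambda>ans. k (\<lambda>T. the (map_of (zip qs ans) T)))"

lemma run_ask:
  "\<exists>g. (\<forall>T\<in>set qs. g T = f T) \<and>
     run f (ask qs k) = map_pmf (\<lambda>(S, tr). (S, qs # tr)) (run f (k g))"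
  by (rule exI[of _ "\<lambda>T. the (map_of (zip qs (map f qs)) T)"])
     (simp add: ask_def map_of_zip_map)

text \<open>The element to remove is selected by costs alone, so the selection takes no
  query.\<close>

fun candidates :: "('a \<Rightarrow> real) \<Rightarrow> real \<Rightarrow> 'a state \<Rightarrow> 'a set list" where
  "candidates c B (\<theta>, A, X) =
     (if sum c A \<le> B then [A]
      else let a = (SOME a. a \<in> A \<and> sum c (A - {a}) \<le> B) in [A - {a}, {a}])"

definition best :: "('a set \<Rightarrow> real) \<Rightarrow> 'a set list \<Rightarrow> 'a set" where
  "best g Ts = (SOME S. S \<in> set Ts \<and> (\<forall>T\<in>set Ts. g T \<le> g S))"

lemma best_cong:
  assumes "\<And>T. T \<in> set Ts \<Longrightarrow> g T = h T"
  shows "best g Ts = best h Ts"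
proof -
  have "(\<lambda>S. S \<in> set Ts \<and> (\<forall>T\<in>set Ts. g T \<le> g S)) = (\<lambda>S. S \<in> set Ts \<and> (\<forall>T\<in>set Ts. h T \<le> h S))"
    using assms by (intro ext) auto
  thus ?thesis by (simp add: best_def)
qed

lemma best_maximal:
  assumes "Ts \<noteq> []"
  shows "best g Ts \<in> set Ts" "T \<in> set Ts \<Longrightarrow> g T \<le> g (best g Ts)"
proof -
  have "Max (g ` set Ts) \<in> g ` set Ts" using assms by (intro Max_in) auto
  then obtain S where "S \<in> set Ts" "g S = Max (g ` set Ts)" by auto
  hence "S \<in> set Ts \<and> (\<forall>T\<in>set Ts. g T \<le> g S)" by simp
  hence "best g Ts \<in> set Ts \<and> (\<forall>T\<in>set Ts. g T \<le> g (best g Ts))"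
    unfolding best_def by (rule someI)
  thus "best g Ts \<in> set Ts" "T \<in> set Ts \<Longrightarrow> g T \<le> g (best g Ts)" by auto
qed

text \<open>There is one state per guess. All states advance in the same round with the same
  permutation, so the number of guesses multiplies the queries but not the rounds.\<close>

primrec loop :: "real \<Rightarrow> ('a \<Rightarrow> real) \<Rightarrow> real \<Rightarrow> 'a list list \<Rightarrow> 'a state list \<Rightarrow> 'a oracle_alg" where
  "loop \<eta> c B [] ss =
     (let Ts = concat (map (candidates c B) ss) in ask Ts (\<lambda>g. Return (best g Ts)))"
| "loop \<eta> c B (\<pi> # \<pi>s) ss =
     ask (concat (map (step_queries \<eta> c B \<pi>) ss)) (\<lambda>g. loop \<eta> c B \<pi>s (map (step \<eta> c B g \<pi>) ss))"

primrec transcript ::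
  "real \<Rightarrow> ('a \<Rightarrow> real) \<Rightarrow> real \<Rightarrow> ('a set \<Rightarrow> real) \<Rightarrow> 'a list list \<Rightarrow> 'a state list \<Rightarrow> 'a set list list"
  where
  "transcript \<eta> c B f [] ss = [concat (map (candidates c B) ss)]"
| "transcript \<eta> c B f (\<pi> # \<pi>s) ss =
     concat (map (step_queries \<eta> c B \<pi>) ss) # transcript \<eta> c B f \<pi>s (map (step \<eta> c B f \<pi>) ss)"

primrec total_loss ::
  "real \<Rightarrow> ('a \<Rightarrow> real) \<Rightarrow> real \<Rightarrow> ('a set \<Rightarrow> real) \<Rightarrow> 'a list list \<Rightarrow> 'a state \<Rightarrow> real" where
  "total_loss \<eta> c B f [] s = 0"
| "total_loss \<eta> c B f (\<pi> # \<pi>s) s =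
     step_loss \<eta> c B f \<pi> s + total_loss \<eta> c B f \<pi>s (step \<eta> c B f \<pi> s)"

text \<open>
  Each step shrinks the cost of \<open>X\<close>, which lies between \<open>\<eta> B / n\<close> and \<open>n B\<close>, by a factor \<open>1 - \<eta>\<close>, so
  \<open>ln (n\<^sup>2 / \<eta>) / \<eta>\<close> steps exhaust it. For \<open>\<eta> < 1 / n\<close> this is not \<open>O(ln n / \<eta>)\<close>, but then \<open>n < 1 / \<eta>\<close>
  steps suffice because each one removes an element of \<open>X\<close>.
\<close>

definition iterations :: "real \<Rightarrow> nat \<Rightarrow> nat" where
  "iterations \<eta> n = (if \<eta> * n < 1 then n else Suc (nat \<lceil>3 * ln n / \<eta>\<rceil>))"

text \<open>With \<open>M\<close> the largest value of a singleton, the optimum lies between \<open>M\<close> and \<open>n M\<close>.\<close>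

definition guesses :: "real \<Rightarrow> nat \<Rightarrow> nat" where
  "guesses \<eta> n = Suc (nat \<lfloor>log (1 + \<eta>) n\<rfloor>)"

text \<open>The quotient \<open>n ^ 2 / \<eta>\<close> is the largest possible cost
  \<open>n * B\<close> over the unit \<open>\<eta> * B / n\<close>. The minimum with
  \<open>Suc n\<close> is for \<open>\<eta> < 1 / n\<close>, where the logarithm of this quotient is
  not controlled by \<open>ln n\<close>.\<close>

definition probe_bound :: "real \<Rightarrow> nat \<Rightarrow> nat" where
  "probe_bound \<eta> n = min (Suc n) (Suc (Suc (nat \<lfloor>log (1 + \<eta>) (real n ^ 2 / \<eta>)\<rfloor>)))"

text \<open>The factor 2/3 balances the two outcomes: for a guess \<open>v\<close>, both
  \<open>v - \<theta> * B\<close> and \<open>\<theta> * B / 2\<close> equal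
  \<open>v / 3\<close>.\<close>

definition start :: "real \<Rightarrow> 'a set \<Rightarrow> ('a \<Rightarrow> real) \<Rightarrow> real \<Rightarrow> ('a set \<Rightarrow> real) \<Rightarrow> 'a state list" where
  "start \<eta> N c B g =
     map (\<lambda>j. (2 / 3 * (Max ((\<lambda>x. g {x}) ` N) * (1 + \<eta>) ^ j) / B,
                cheap_elements \<eta> N c B, N - cheap_elements \<eta> N c B))
       [0..<guesses \<eta> (card N)]"

definition search :: "real \<Rightarrow> 'a set \<Rightarrow> ('a \<Rightarrow> real) \<Rightarrow> real \<Rightarrow> 'a list list \<Rightarrow> 'a oracle_alg" where
  "search \<eta> N c B \<pi>s =
     ask (map (\<lambda>x. {x}) (SOME xs. xs \<in> permutations_of_set N))
       (\<lambda>g. loop \<eta> c B \<pi>s (start \<eta> N c B g))"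

text \<open>All permutations are drawn in advance, so that the rest of the run is deterministic once
  they are fixed. Ground sets of size at most 1 are answered without queries, since
  \<open>ln n\<close> vanishes at \<open>n = 1\<close>.\<close>

definition parallel_knapsack :: "real \<Rightarrow> 'a knapsack_alg" where
  "parallel_knapsack \<eta> N c B =
     (if card N \<le> 1 then Return N
      else Flip (map_pmf (search \<eta> N c B)
        (replicate_pmf (iterations \<eta> (card N)) (pmf_of_set (permutations_of_set N)))))"

section \<open>Bounds on the optimum\<close>

context knapsack
begin

lemma finite_feasible: "finite {T. feasible N c B T}"
  by (rule finite_subset[of _ "Pow N"]) (auto simp: feasible_def fin)

lemma OPT_upper: "feasible N c B T \<Longrightarrow> f T \<le> OPT N c B f"
  unfolding OPT_def using finite_feasible by (intro Max_ge) auto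

lemma OPT_attained: obtains T where "feasible N c B T" "f T = OPT N c B f"
proof -
  have "{} \<in> {T. feasible N c B T}" using budget_pos by (simp add: feasible_def)
  hence "OPT N c B f \<in> f ` {T. feasible N c B T}"
    unfolding OPT_def using finite_feasible by (intro Max_in) auto
  thus ?thesis using that by auto
qed

lemma feasible_singleton: "x \<in> N \<Longrightarrow> feasible N c B {x}"
  using cost_le by (simp add: feasible_def)

lemma OPT_bounds:
  assumes "N \<noteq> {}"
  defines "M \<equiv> Max ((\<lambda>x. f {x}) ` N)"
  shows "0 \<le> (M :: real)" "M \<le> OPT N c B f" "OPT N c B f \<le> real (card N) * M"
proof -
  have le: "f {x} \<le> M" if "x \<in> N" for x
    unfolding M_def using fin that by (intro Max_ge) auto
  have "M \<in> (\<lambda>x. f {x}) ` N" unfolding M_def using fin assms by (intro Max_in) auto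
  then obtain x where x: "x \<in> N" "M = f {x}" by auto
  show "0 \<le> M" unfolding x(2) using x(1) by (intro nonneg) auto
  show "M \<le> OPT N c B f" unfolding x(2) using OPT_upper feasible_singleton x(1) by blast
  \<comment> \<open>The induction starts at singletons since \<open>f {}\<close> may be
    positive.\<close>
  have upper: "f T \<le> card T * M" if "T \<subseteq> N" "T \<noteq> {}" for T
    using finite_subset_N[OF that(1)] that(2,1)
  proof (induction T rule: finite_ne_induct)
    case (insert a T)
    thus ?case using subadditive_singleton[of T a] le[of a] by (auto simp: algebra_simps)
  qed (use le in auto)
  obtain T where T: "feasible N c B T" "f T = OPT N c B f" by (rule OPT_attained)
  have "f T \<le> f N" using T by (intro mono) (auto simp: feasible_def)
  also have "\<dots> \<le> card N * M" using upper assms by auto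
  finally show "OPT N c B f \<le> real (card N) * M" using T by simp
qed

end

section \<open>Analysis of the iterated rounds\<close>

context threshold_search
begin

lemma candidates_cases:
  assumes "wf_state (\<theta>, A, X)"
  obtains "sum c A \<le> B" "candidates c B (\<theta>, A, X) = [A]"
  | a where "B < sum c A" "a \<in> A" "sum c (A - {a}) \<le> B"
      "candidates c B (\<theta>, A, X) = [A - {a}, {a}]"
proof (cases "sum c A \<le> B")
  case False
  define a where "a = (SOME a. a \<in> A \<and> sum c (A - {a}) \<le> B)"
  have "\<exists>a. a \<in> A \<and> sum c (A - {a}) \<le> B" using assms False by (auto simp: wf_state_def)
  hence "a \<in> A \<and> sum c (A - {a}) \<le> B" unfolding a_def by (rule someI_ex)
  thus ?thesis using that(2)[of a] False by (auto simp: a_def Let_def)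
qed (use that in auto)

lemma candidates_facts:
  assumes "wf_state s"
  shows "candidates c B s \<noteq> []" "length (candidates c B s) \<le> 2"
    "T \<in> set (candidates c B s) \<Longrightarrow> feasible N c B T"
proof -
  obtain \<theta> A X where s: "s = (\<theta>, A, X)" by (cases s)
  have AN: "A \<subseteq> N" using assms by (auto simp: s wf_state_def)
  have "candidates c B s \<noteq> [] \<and> length (candidates c B s) \<le> 2 \<and>
      (\<forall>T\<in>set (candidates c B s). feasible N c B T)"
    using assms unfolding s
    by (rule candidates_cases) (use AN feasible_singleton in \<open>auto simp: feasible_def\<close>)
  thus "candidates c B s \<noteq> []" "length (candidates c B s) \<le> 2"
    "T \<in> set (candidates c B s) \<Longrightarrow> feasible N c B T" by auto
qed

lemma wf_step': "wf_state s \<Longrightarrow> \<pi> \<in> permutations_of_set N \<Longrightarrow> wf_state (step \<eta> c B f \<pi> s)"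
  using wf_step by (cases s) auto

text \<open>By \<open>step_cong\<close> and \<open>best_cong\<close> the partial copy of the oracle
  may be replaced by \<open>f\<close> in every round. So for fixed permutations the run is a point
  mass, and the analysis can speak of \<open>fold\<close> instead of an interaction.\<close>

lemma run_loop:
  assumes "\<And>s. s \<in> set ss \<Longrightarrow> wf_state s" "set \<pi>s \<subseteq> permutations_of_set N"
  shows "run f (loop \<eta> c B \<pi>s ss) =
    return_pmf (best f (concat (map (candidates c B \<circ> fold (step \<eta> c B f) \<pi>s) ss)),
      transcript \<eta> c B f \<pi>s ss)"
  using assms
proof (induction \<pi>s arbitrary: ss)
  case Nil
  let ?Ts = "concat (map (candidates c B) ss)"
  obtain g where g: "\<And>T. T \<in> set ?Ts \<Longrightarrow> g T = f T"
    "run f (ask ?Ts (\<lambda>g. Return (best g ?Ts))) =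
     map_pmf (\<lambda>(S, tr). (S, ?Ts # tr)) (run f (Return (best g ?Ts)))"
    using run_ask[of ?Ts f "\<lambda>g. Return (best g ?Ts)"] by blast
  have "best g ?Ts = best f ?Ts" using g(1) by (rule best_cong)
  thus ?case using g(2) by (simp add: Let_def comp_def)
next
  case (Cons \<pi> \<pi>s)
  let ?qs = "concat (map (step_queries \<eta> c B \<pi>) ss)"
  obtain g where g: "\<And>T. T \<in> set ?qs \<Longrightarrow> g T = f T"
    "run f (ask ?qs (\<lambda>g. loop \<eta> c B \<pi>s (map (step \<eta> c B g \<pi>) ss))) =
     map_pmf (\<lambda>(S, tr). (S, ?qs # tr)) (run f (loop \<eta> c B \<pi>s (map (step \<eta> c B g \<pi>) ss)))"
    using run_ask[of ?qs f "\<lambda>g. loop \<eta> c B \<pi>s (map (step \<eta> c B g \<pi>) ss)"] by blast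
  have "step \<eta> c B g \<pi> s = step \<eta> c B f \<pi> s" if "s \<in> set ss" for s
  proof -
    obtain \<theta> A X where s: "s = (\<theta>, A, X)" by (cases s)
    have "g T = f T" if "T \<in> set (step_queries \<eta> c B \<pi> s)" for T
      using that \<open>s \<in> set ss\<close> by (intro g(1)) auto
    moreover have "wf_state s" "\<pi> \<in> permutations_of_set N" using Cons.prems that by auto
    ultimately show ?thesis unfolding s by (intro step_cong) auto
  qed
  hence map_eq: "map (step \<eta> c B g \<pi>) ss = map (step \<eta> c B f \<pi>) ss" by simp
  have IH: "run f (loop \<eta> c B \<pi>s (map (step \<eta> c B f \<pi>) ss)) =
    return_pmf (best f (concat (map (candidates c B \<circ> fold (step \<eta> c B f) \<pi>s)
      (map (step \<eta> c B f \<pi>) ss))), transcript \<eta> c B f \<pi>s (map (step \<eta> c B f \<pi>) ss))"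
    using Cons.prems wf_step' by (intro Cons.IH) auto
  show ?case using g(2) unfolding map_eq IH by (simp add: comp_def)
qed

lemma card_probes:
  assumes "wf_state (\<theta>, A, X)" "\<pi> \<in> permutations_of_set N"
  shows "card (probes \<eta> c B X \<pi>) \<le> probe_bound \<eta> (card N)"
proof -
  note facts = perm_facts[OF assms] picked_cost[OF assms] picked_cost_mono[OF assms]
  have "sum c (picked X \<pi> (card N)) = sum c X" using picked_all[OF assms] by simp
  also have "\<dots> \<le> (\<Sum>x\<in>X. B)"
    using state_subsets[OF assms] cost_le by (intro sum_mono) auto
  also have "\<dots> \<le> card N * B"
    using state_subsets[OF assms] fin budget_pos by (simp add: card_mono)
  finally have "card (probes \<eta> c B X \<pi>) \<le> Suc (level \<eta> unit (card N * B))"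
    unfolding probes_def facts(3) using facts eta unit_pos by (intro card_grid_le_level) auto
  also have "level \<eta> unit (card N * B) = Suc (nat \<lfloor>log (1 + \<eta>) (real (card N) ^ 2 / \<eta>)\<rfloor>)"
    using budget_pos card_pos by (simp add: level_def power2_eq_square)
  finally show ?thesis
    using card_grid_le_length unfolding probes_def facts(3) probe_bound_def by (simp add: min_def)
qed

lemma step_queries_facts:
  assumes "wf_state s" "\<pi> \<in> permutations_of_set N"
  shows "length (step_queries \<eta> c B \<pi> s) \<le> probe_bound \<eta> (card N) * Suc (card N)"
    "T \<in> set (step_queries \<eta> c B \<pi> s) \<Longrightarrow> T \<subseteq> N"
proof -
  obtain \<theta> A X where s: "s = (\<theta>, A, X)" by (cases s)
  note wf = assms[unfolded s]
  have len: "length (step_queries \<eta> c B \<pi> s) = card (probes \<eta> c B X \<pi>) * Suc (card N)"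
    using perm_facts[OF wf] by (simp add: s length_concat comp_def sum_list_triv)
  show "length (step_queries \<eta> c B \<pi> s) \<le> probe_bound \<eta> (card N) * Suc (card N)"
    unfolding len using card_probes[OF wf] by (rule mult_le_mono1)
  have "finite (probes \<eta> c B X \<pi>)" by (simp add: probes_def)
  thus "T \<in> set (step_queries \<eta> c B \<pi> s) \<Longrightarrow> T \<subseteq> N"
    using perm_facts(1)[OF wf] state_subsets(2,3)[OF wf] by (auto simp: s picked_def)
qed

lemma transcript_facts:
  assumes "\<And>s. s \<in> set ss \<Longrightarrow> wf_state s" "set \<pi>s \<subseteq> permutations_of_set N"
  shows "length (transcript \<eta> c B f \<pi>s ss) = Suc (length \<pi>s) \<and>
    length (concat (transcript \<eta> c B f \<pi>s ss)) \<le>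
      length \<pi>s * (length ss * (probe_bound \<eta> (card N) * Suc (card N))) + length ss * 2 \<and>
    (\<forall>qs\<in>set (transcript \<eta> c B f \<pi>s ss). \<forall>T\<in>set qs. T \<subseteq> N)"
  using assms
proof (induction \<pi>s arbitrary: ss)
  case Nil
  have "T \<subseteq> N" if "s \<in> set ss" "T \<in> set (candidates c B s)" for s T
    using candidates_facts(3)[OF Nil(1)] that unfolding feasible_def by blast
  moreover have "length (concat (map (candidates c B) ss)) \<le> length ss * 2"
    using Nil candidates_facts(2) by (intro length_concat_map_le) auto
  ultimately show ?case by simp
next
  case (Cons \<pi> \<pi>s)
  let ?m = "length ss * (probe_bound \<eta> (card N) * Suc (card N))"
  let ?ss = "map (step \<eta> c B f \<pi>) ss"
  have "length (concat (map (step_queries \<eta> c B \<pi>) ss)) \<le> ?m"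
    using Cons.prems step_queries_facts(1) by (intro length_concat_map_le) auto
  moreover have "T \<subseteq> N" if "s \<in> set ss" "T \<in> set (step_queries \<eta> c B \<pi> s)" for s T
    using Cons.prems that step_queries_facts(2)[of s \<pi> T] by auto
  moreover have "length (transcript \<eta> c B f \<pi>s ?ss) = Suc (length \<pi>s) \<and>
    length (concat (transcript \<eta> c B f \<pi>s ?ss)) \<le>
      length \<pi>s * (length ?ss * (probe_bound \<eta> (card N) * Suc (card N))) + length ?ss * 2 \<and>
    (\<forall>qs\<in>set (transcript \<eta> c B f \<pi>s ?ss). \<forall>T\<in>set qs. T \<subseteq> N)"
    using Cons.prems wf_step' by (intro Cons.IH) auto
  ultimately show ?case by simp
qed

text \<open>Two measures of progress are kept: the number of elements of \<open>X\<close> for the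
  case \<open>\<eta> * n < 1\<close> and their cost for the other case. The gains telescope.\<close>

lemma fold_step_facts:
  assumes "wf_state (\<theta>, A, X)" "set \<pi>s \<subseteq> permutations_of_set N" "0 \<le> \<theta>"
    and "fold (step \<eta> c B f) \<pi>s (\<theta>, A, X) = (\<theta>', A', X')"
  shows "wf_state (\<theta>', A', X') \<and> \<theta>' = \<theta> \<and> sum c X' \<le> (1 - \<eta>) ^ length \<pi>s * sum c X \<and>
    card X' \<le> card X - length \<pi>s \<and> 0 \<le> total_loss \<eta> c B f \<pi>s (\<theta>, A, X) \<and>
    f A + \<theta> * (sum c A' - sum c A - total_loss \<eta> c B f \<pi>s (\<theta>, A, X)) \<le> f A'"
  using assms
proof (induction \<pi>s arbitrary: A X)
  case (Cons \<pi> \<pi>s)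
  have perm: "\<pi> \<in> permutations_of_set N" using Cons.prems by simp
  obtain \<theta>1 A1 X1 where "step \<eta> c B f \<pi> (\<theta>, A, X) = (\<theta>1, A1, X1)"
    by (cases "step \<eta> c B f \<pi> (\<theta>, A, X)")
  moreover from step_progress(1)[OF Cons.prems(1) perm this] have "\<theta>1 = \<theta>" .
  ultimately have s: "step \<eta> c B f \<pi> (\<theta>, A, X) = (\<theta>, A1, X1)" by simp
  note prog = step_progress[OF Cons.prems(1) perm s]
  have wf: "wf_state (\<theta>, A1, X1)" using wf_step[OF Cons.prems(1) perm] s by simp
  have IH: "wf_state (\<theta>', A', X') \<and> \<theta>' = \<theta> \<and> sum c X' \<le> (1 - \<eta>) ^ length \<pi>s * sum c X1 \<and>
    card X' \<le> card X1 - length \<pi>s \<and> 0 \<le> total_loss \<eta> c B f \<pi>s (\<theta>, A1, X1) \<and>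
    f A1 + \<theta> * (sum c A' - sum c A1 - total_loss \<eta> c B f \<pi>s (\<theta>, A1, X1)) \<le> f A'"
    using Cons.prems wf s by (intro Cons.IH) auto
  have "(1 - \<eta>) ^ length \<pi>s * sum c X1 \<le> (1 - \<eta>) ^ length \<pi>s * ((1 - \<eta>) * sum c X)"
    using prog(4) eta by (intro mult_left_mono) auto
  hence "sum c X' \<le> (1 - \<eta>) ^ length (\<pi> # \<pi>s) * sum c X" using IH by (simp add: mult_ac)
  moreover have "card X1 \<le> card X - 1"
  proof (cases "X = {}")
    case False
    have "finite X" using state_subsets[OF Cons.prems(1) perm] finite_subset_N by blast
    thus ?thesis using psubset_card_mono[of X X1] prog(5) False by simp
  qed (use prog(3) in auto)
  moreover have "f A + \<theta> * (sum c A1 - sum c A - step_loss \<eta> c B f \<pi> (\<theta>, A, X)) \<le> f A1"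
    using step_gain(2)[OF Cons.prems(1) perm s] Cons.prems by simp
  moreover have "0 \<le> step_loss \<eta> c B f \<pi> (\<theta>, A, X)"
    using step_loss_nonneg[OF Cons.prems(1) perm] by simp
  ultimately show ?case using IH by (auto simp: s algebra_simps simp del: step.simps step_loss.simps)
qed auto

text \<open>Given the first permutation, the others are still independent and uniform, so the
  induction hypothesis applies to the state reached. Bounding the loss of a round by the cost it
  adds makes the sum telescope, whatever the number of rounds.\<close>

lemma expectation_total_loss:
  assumes "wf_state (\<theta>, A, X)" "0 \<le> \<theta>"
  defines "P \<equiv> \<lambda>k. replicate_pmf k (pmf_of_set (permutations_of_set N))"
  shows "measure_pmf.expectation (P k) (\<lambda>\<pi>s. total_loss \<eta> c B f \<pi>s (\<theta>, A, X)) \<le>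
    measure_pmf.expectation (P k)
      (\<lambda>\<pi>s. 2 * \<eta> * (sum c (fst (snd (fold (step \<eta> c B f) \<pi>s (\<theta>, A, X)))) - sum c A))"
  using assms(1)
proof (induction k arbitrary: A X)
  case 0
  thus ?case by (simp add: P_def)
next
  case (Suc k)
  let ?p = "pmf_of_set (permutations_of_set N)"
  let ?E = "measure_pmf.expectation ?p :: _ \<Rightarrow> real" and ?E' = "measure_pmf.expectation (P k) :: _ \<Rightarrow> real"
  let ?step = "\<lambda>\<pi>. step \<eta> c B f \<pi> (\<theta>, A, X)"
  let ?cost = "\<lambda>s. sum c (fst (snd s))"
  have set_p: "set_pmf ?p = permutations_of_set N"
    using fin by (intro set_pmf_of_set) auto
  hence finp: "finite (set_pmf ?p)" by simp
  have finP: "finite (set_pmf (P k))"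
    unfolding P_def set_replicate_pmf using finite_lists_length_eq[OF finp, of k]
    by (auto simp: lists_eq_set elim: rev_finite_subset)
  have integ: "integrable (measure_pmf ?p) (h :: _ \<Rightarrow> real)" for h
    using finp by (rule integrable_measure_pmf_finite)
  have integ': "integrable (measure_pmf (P k)) (h :: _ \<Rightarrow> real)" for h
    using finP by (rule integrable_measure_pmf_finite)
  have unroll: "measure_pmf.expectation (P (Suc k)) h = ?E (\<lambda>\<pi>. ?E' (\<lambda>\<pi>s. h (\<pi> # \<pi>s)))"
    for h :: "'a list list \<Rightarrow> real"
    using finp finP unfolding P_def
    by (simp add: expectation_bind_finite map_pmf_def[symmetric])
  have "measure_pmf.expectation (P (Suc k)) (\<lambda>\<pi>s. total_loss \<eta> c B f \<pi>s (\<theta>, A, X)) =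
      ?E (\<lambda>\<pi>. step_loss \<eta> c B f \<pi> (\<theta>, A, X)) + ?E (\<lambda>\<pi>. ?E' (\<lambda>\<pi>s. total_loss \<eta> c B f \<pi>s (?step \<pi>)))"
    unfolding unroll using integ integ' by (simp del: step.simps step_loss.simps)
  also have "\<dots> \<le> ?E (\<lambda>\<pi>. 2 * \<eta> * (?cost (?step \<pi>) - sum c A)) +
      ?E (\<lambda>\<pi>. ?E' (\<lambda>\<pi>s. 2 * \<eta> * (?cost (fold (step \<eta> c B f) \<pi>s (?step \<pi>)) - ?cost (?step \<pi>))))"
  proof (intro add_mono expectation_step_loss[OF Suc.prems assms(2)]
      expectation_mono_finite[OF finp], unfold set_p)
    fix \<pi> assume perm: "\<pi> \<in> permutations_of_set N"
    obtain \<theta>1 A1 X1 where s1: "?step \<pi> = (\<theta>1, A1, X1)" by (cases "?step \<pi>")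
    moreover from step_progress(1)[OF Suc.prems perm this] have "\<theta>1 = \<theta>" .
    ultimately have s: "?step \<pi> = (\<theta>, A1, X1)" by simp
    have "wf_state (\<theta>, A1, X1)" using wf_step[OF Suc.prems perm] s by simp
    from Suc.IH[OF this]
    show "?E' (\<lambda>\<pi>s. total_loss \<eta> c B f \<pi>s (?step \<pi>)) \<le>
        ?E' (\<lambda>\<pi>s. 2 * \<eta> * (?cost (fold (step \<eta> c B f) \<pi>s (?step \<pi>)) - ?cost (?step \<pi>)))"
      unfolding s by simp
  qed
  also have "\<dots> = measure_pmf.expectation (P (Suc k))
      (\<lambda>\<pi>s. 2 * \<eta> * (?cost (fold (step \<eta> c B f) \<pi>s (\<theta>, A, X)) - sum c A))"
    unfolding unroll using integ integ'
    by (simp add: right_diff_distrib del: step.simps step_loss.simps)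
  finally show ?case .
qed

text \<open>If \<open>\<eta> * n \<ge> 1\<close>, the count makes \<open>(1 - \<eta>) ^ k\<close>
  smaller than \<open>1 / n ^ 3\<close>, so the cost falls below \<open>B / n ^ 2\<close>, which is
  at most \<open>unit\<close>.\<close>

lemma iterations_suffice:
  assumes "2 \<le> card N"
  shows "card N \<le> iterations \<eta> (card N) \<or>
    (1 - \<eta>) ^ iterations \<eta> (card N) * (card N * B) < unit"
proof (cases "\<eta> * card N < 1")
  case False
  define n where "n = real (card N)"
  define k where "k = iterations \<eta> (card N)"
  have n: "2 \<le> n" "1 \<le> \<eta> * n" using assms False by (auto simp: n_def)
  have "3 * ln n / \<eta> < real k"
    using False by (simp add: k_def iterations_def n_def) linarith
  hence k: "3 * ln n < \<eta> * k" using eta by (simp add: field_simps)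
  have "(1 - \<eta>) ^ k \<le> exp (-\<eta>) ^ k"
    using eta exp_ge_add_one_self[of "-\<eta>"] by (intro power_mono) auto
  also have "\<dots> = exp (- (\<eta> * k))" by (simp add: exp_of_nat_mult[symmetric] mult_ac)
  also have "\<dots> < exp (- (3 * ln n))" using k by simp
  also have "\<dots> = 1 / n ^ 3"
    using n by (simp add: exp_minus exp_of_nat_mult[of 3, simplified] divide_inverse)
  finally have "(1 - \<eta>) ^ k * (n * B) < 1 / n ^ 3 * (n * B)"
    using n budget_pos by (intro mult_strict_right_mono) auto
  also have "\<dots> = (1 / n) * B / n" using n by (simp add: field_simps power3_eq_cube)
  also have "\<dots> \<le> \<eta> * B / n"
    using n budget_pos by (intro divide_right_mono mult_right_mono) (auto simp: field_simps)
  finally show ?thesis by (simp add: n_def k_def)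
qed (simp add: iterations_def)

text \<open>The first entry of the minimum belongs to a solution that fits the budget, the second to
  an overfull one, whose better part has at least half the value. Subtracting the nonnegative loss
  in the first case too gives one formula.\<close>

lemma good_candidate:
  assumes "2 \<le> card N" "0 \<le> \<theta>" "length \<pi>s = iterations \<eta> (card N)" "set \<pi>s \<subseteq> permutations_of_set N"
  defines "s \<equiv> (\<theta>, cheap, N - cheap)"
  shows "wf_state s" "\<exists>T\<in>set (candidates c B (fold (step \<eta> c B f) \<pi>s s)).
      min (OPT N c B f - \<theta> * B) (\<theta> * (1 - \<eta>) * B / 2) - \<theta> * total_loss \<eta> c B f \<pi>s s / 2 \<le> f T"
    "sum c (fst (snd (fold (step \<eta> c B f) \<pi>s s))) \<le> 2 * B"
proof -
  have "\<eta> * B \<le> B" using eta budget_pos by (simp add: mult_le_cancel_right1)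
  hence "sum c cheap \<le> B" using cost_cheap by linarith
  thus wf: "wf_state s" by (auto simp: s_def wf_state_def cheap_def)
  obtain \<theta>' A X where res': "fold (step \<eta> c B f) \<pi>s s = (\<theta>', A, X)"
    by (cases "fold (step \<eta> c B f) \<pi>s s")
  note fold' = fold_step_facts[OF wf[unfolded s_def] assms(4,2) res'[unfolded s_def]]
  hence res: "fold (step \<eta> c B f) \<pi>s s = (\<theta>, A, X)" using res' by simp
  define loss where "loss = total_loss \<eta> c B f \<pi>s s"
  have fold: "wf_state (\<theta>, A, X)" "sum c X \<le> (1 - \<eta>) ^ length \<pi>s * sum c (N - cheap)"
    "card X \<le> card (N - cheap) - length \<pi>s" "0 \<le> loss"
    "f cheap + \<theta> * (sum c A - sum c cheap - loss) \<le> f A"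
    using fold' unfolding loss_def s_def by auto
  have sub: "A \<subseteq> N" "X \<subseteq> N" "cheap \<subseteq> A" "A \<inter> X = {}" using fold(1) by (auto simp: wf_state_def)
  \<comment> \<open>Either there are enough rounds to remove the elements one by one, or the
    remaining cost is below that of any single element that is not cheap.\<close>
  have "X = {}"
  proof (cases "card N \<le> iterations \<eta> (card N)")
    case True
    have "card (N - cheap) \<le> card N" using fin by (intro card_mono) auto
    hence "card X = 0" using fold(3) True assms(3) by simp
    thus ?thesis using finite_subset_N[OF sub(2)] by simp
  next
    case False
    have "sum c (N - cheap) \<le> sum c N" by (intro cost_mono) auto
    also have "\<dots> \<le> (\<Sum>x\<in>N. B)" using cost_le by (intro sum_mono)
    finally have "sum c (N - cheap) \<le> card N * B" by simp
    hence "(1 - \<eta>) ^ length \<pi>s * sum c (N - cheap) \<le> (1 - \<eta>) ^ length \<pi>s * (card N * B)"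
      using eta by (intro mult_left_mono) auto
    hence small: "sum c X < unit"
      using fold(2) iterations_suffice[OF assms(1)] False assms(3) by simp
    show ?thesis
    proof (rule ccontr)
      assume "X \<noteq> {}"
      then obtain x where x: "x \<in> X" by auto
      hence "unit \<le> c x" using sub by (force simp: cheap_def)
      also have "c x = sum c {x}" by simp
      also have "\<dots> \<le> sum c X" using x sub by (intro cost_mono) auto
      finally show False using small by simp
    qed
  qed
  have cA: "sum c A \<le> 2 * B \<and> (\<exists>T\<in>set (candidates c B (\<theta>, A, X)).
      min (OPT N c B f - \<theta> * B) (\<theta> * (1 - \<eta>) * B / 2) - \<theta> * loss / 2 \<le> f T)"
    using fold(1)
  proof (cases rule: candidates_cases)
    case 1
    obtain T where T: "feasible N c B T" "f T = OPT N c B f" by (rule OPT_attained)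
    hence TN: "T \<subseteq> N" by (simp add: feasible_def)
    have marg: "f (insert x A) - f A \<le> \<theta> * c x" if "x \<in> N - A" for x
      using fold(1) 1(1) that \<open>X = {}\<close> by (auto simp: wf_state_def)
    have "f T - f A \<le> f (A \<union> (T - A)) - f A" using TN sub mono[of T "A \<union> (T - A)"] by auto
    also have "\<dots> \<le> (\<Sum>x\<in>T - A. f (insert x A) - f A)"
      using TN sub by (intro gain_le_sum_marginals) auto
    also have "\<dots> \<le> (\<Sum>x\<in>T - A. \<theta> * c x)" using TN marg by (intro sum_mono) auto
    also have "\<dots> = \<theta> * sum c (T - A)" by (simp add: sum_distrib_left)
    also have "\<dots> \<le> \<theta> * B"
      using cost_mono[of "T - A" T] TN T(1) assms(2)
      by (intro mult_left_mono) (auto simp: feasible_def)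
    finally have "OPT N c B f - \<theta> * B \<le> f A" using T by simp
    moreover have "0 \<le> \<theta> * loss" using assms(2) fold(4) by simp
    ultimately have "min (OPT N c B f - \<theta> * B) (\<theta> * (1 - \<eta>) * B / 2) - \<theta> * loss / 2 \<le> f A"
      by linarith
    thus ?thesis using 1 budget_pos by (simp del: candidates.simps)
  next
    case (2 a)
    have ins: "insert a (A - {a}) = A" using 2(2) by auto
    have "f A \<le> f (A - {a}) + f {a}"
      using subadditive_singleton[of "A - {a}" a] sub 2(2) unfolding ins by auto
    moreover have "\<theta> * ((1 - \<eta>) * B - loss) \<le> f A"
    proof -
      \<comment> \<open>The solution costs more than \<open>B\<close>, of which the cheap elements,
        taken without regard to density, make up at most \<open>\<eta> * B\<close>.\<close>
      have "\<theta> * ((1 - \<eta>) * B - loss) \<le> \<theta> * (sum c A - sum c cheap - loss)"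
        using 2(1) cost_cheap assms(2) by (intro mult_left_mono) (auto simp: algebra_simps)
      moreover have "0 \<le> f cheap" using sub by (intro nonneg) blast
      ultimately show ?thesis using fold(5) by linarith
    qed
    ultimately have "\<theta> * (1 - \<eta>) * B / 2 - \<theta> * loss / 2 \<le> max (f (A - {a})) (f {a})"
      by (simp add: algebra_simps max_def)
    hence "min (OPT N c B f - \<theta> * B) (\<theta> * (1 - \<eta>) * B / 2) - \<theta> * loss / 2 \<le> max (f (A - {a})) (f {a})"
      by linarith
    moreover have "sum c A \<le> 2 * B"
      using sum.remove[of A a c] 2 finite_subset_N[OF sub(1)] cost_le[of a] sub by auto
    ultimately show ?thesis unfolding 2(4) by (auto simp: max_def split: if_splits)
  qed
  show "\<exists>T\<in>set (candidates c B (fold (step \<eta> c B f) \<pi>s s)).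
      min (OPT N c B f - \<theta> * B) (\<theta> * (1 - \<eta>) * B / 2) - \<theta> * total_loss \<eta> c B f \<pi>s s / 2 \<le> f T"
    using cA unfolding res loss_def by blast
  show "sum c (fst (snd (fold (step \<eta> c B f) \<pi>s s))) \<le> 2 * B" using cA unfolding res by simp
qed

lemma guess_exists:
  defines "M \<equiv> Max ((\<lambda>x. f {x}) ` N)"
  shows "\<exists>j<guesses \<eta> (card N).
    M * (1 + \<eta>) ^ j \<le> OPT N c B f \<and> OPT N c B f \<le> (1 + \<eta>) * (M * (1 + \<eta>) ^ j)"
proof (cases "M = 0")
  case True
  thus ?thesis using OPT_bounds[OF N_nonempty] unfolding M_def[symmetric]
    by (intro exI[of _ 0]) (auto simp: guesses_def)
next
  case False
  define r where "r = OPT N c B f / M"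
  have M: "0 < M" "M \<le> OPT N c B f" "OPT N c B f \<le> real (card N) * M"
    using OPT_bounds[OF N_nonempty] False unfolding M_def[symmetric] by auto
  hence r: "1 \<le> r" "r \<le> card N" by (auto simp: r_def field_simps)
  define j where "j = nat \<lfloor>log (1 + \<eta>) r\<rfloor>"
  have log: "0 \<le> log (1 + \<eta>) r" "log (1 + \<eta>) r \<le> log (1 + \<eta>) (card N)" using r eta by auto
  hence "j < guesses \<eta> (card N)"
    unfolding j_def guesses_def by (simp add: nat_mono floor_mono less_Suc_eq_le)
  have "real j \<le> log (1 + \<eta>) r" "log (1 + \<eta>) r \<le> real (Suc j)"
    unfolding j_def using log by linarith+
  hence "(1 + \<eta>) powr real j \<le> r" "r \<le> (1 + \<eta>) powr real (Suc j)"
    using r eta by (simp_all only: le_log_iff log_le_iff)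
  hence "(1 + \<eta>) ^ j \<le> r" "r \<le> (1 + \<eta>) ^ Suc j"
    using eta by (simp_all add: powr_realpow del: of_nat_Suc power_Suc)
  hence "M * (1 + \<eta>) ^ j \<le> OPT N c B f" "OPT N c B f \<le> (1 + \<eta>) * (M * (1 + \<eta>) ^ j)"
    using M by (auto simp: r_def field_simps)
  thus ?thesis using \<open>j < _\<close> by blast
qed

end

subsection \<open>Correctness and complexity\<close>

text \<open>Besides the iterations there is one round for the singletons and one for the
  candidates.\<close>

definition round_bound :: "real \<Rightarrow> nat \<Rightarrow> nat" where
  "round_bound \<eta> n = (if n \<le> 1 then 0 else iterations \<eta> n + 2)"

definition total_query_bound :: "real \<Rightarrow> nat \<Rightarrow> nat" where
  "total_query_bound \<eta> n = (if n \<le> 1 then 0 else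
     n + iterations \<eta> n * (guesses \<eta> n * (probe_bound \<eta> n * Suc n)) + guesses \<eta> n * 2)"

context threshold_search
begin

lemma run_search:
  assumes "set \<pi>s \<subseteq> permutations_of_set N" "2 \<le> card N" "length \<pi>s = iterations \<eta> (card N)"
  defines "ss \<equiv> start \<eta> N c B f"
  shows "\<exists>tr. run f (search \<eta> N c B \<pi>s) =
      return_pmf (best f (concat (map (candidates c B \<circ> fold (step \<eta> c B f) \<pi>s) ss)), tr) \<and>
    length tr = round_bound \<eta> (card N) \<and> length (concat tr) \<le> total_query_bound \<eta> (card N) \<and>
    (\<forall>qs\<in>set tr. \<forall>T\<in>set qs. T \<subseteq> N)"
proof -
  define xs where "xs = (SOME xs. xs \<in> permutations_of_set N)"
  have "xs \<in> permutations_of_set N"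
    unfolding xs_def some_in_eq using fin by simp
  hence xs: "set xs = N" "length xs = card N"
    by (auto simp: permutations_of_set_def distinct_card)
  let ?qs = "map (\<lambda>x. {x}) xs"
  obtain g where g: "\<forall>T\<in>set ?qs. g T = f T" "run f (search \<eta> N c B \<pi>s) =
      map_pmf (\<lambda>(S, tr). (S, ?qs # tr)) (run f (loop \<eta> c B \<pi>s (start \<eta> N c B g)))"
    unfolding search_def xs_def[symmetric]
    using run_ask[of ?qs f "\<lambda>g. loop \<eta> c B \<pi>s (start \<eta> N c B g)"] by blast
  have "(\<lambda>x. g {x}) ` N = (\<lambda>x. f {x}) ` N" using g(1) xs by (intro image_cong) auto
  hence ss: "start \<eta> N c B g = ss" by (simp add: start_def ss_def)
  have wf: "wf_state s" if "s \<in> set ss" for s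
  proof -
    obtain j where s: "s = (2 / 3 * (Max ((\<lambda>x. f {x}) ` N) * (1 + \<eta>) ^ j) / B, cheap, N - cheap)"
      using \<open>s \<in> set ss\<close> by (auto simp: ss_def start_def)
    show ?thesis unfolding s
      using OPT_bounds(1)[OF N_nonempty] eta budget_pos assms
      by (intro good_candidate(1)) auto
  qed
  have "length ss = guesses \<eta> (card N)" by (simp add: ss_def start_def)
  thus ?thesis
    using g(2) run_loop[of ss \<pi>s, OF wf assms(1)] transcript_facts[of ss \<pi>s, OF wf assms(1)] assms(2,3) xs
    by (intro exI[of _ "?qs # transcript \<eta> c B f \<pi>s ss"])
       (auto simp: ss round_bound_def total_query_bound_def)
qed

lemma best_candidate:
  assumes "set \<pi>s \<subseteq> permutations_of_set N" "2 \<le> card N" "length \<pi>s = iterations \<eta> (card N)"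
  defines "S \<equiv> best f (concat (map (candidates c B \<circ> fold (step \<eta> c B f) \<pi>s) (start \<eta> N c B f)))"
  shows "feasible N c B S"
    and "j < guesses \<eta> (card N) \<Longrightarrow> \<theta> = 2 / 3 * (Max ((\<lambda>x. f {x}) ` N) * (1 + \<eta>) ^ j) / B \<Longrightarrow>
      min (OPT N c B f - \<theta> * B) (\<theta> * (1 - \<eta>) * B / 2)
        - \<theta> * total_loss \<eta> c B f \<pi>s (\<theta>, cheap, N - cheap) / 2 \<le> f S"
proof -
  let ?\<theta> = "\<lambda>j. 2 / 3 * (Max ((\<lambda>x. f {x}) ` N) * (1 + \<eta>) ^ j) / B"
  let ?s = "\<lambda>j. (?\<theta> j, cheap, N - cheap)"
  let ?Ts = "concat (map (candidates c B \<circ> fold (step \<eta> c B f) \<pi>s) (start \<eta> N c B f))"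
  have \<theta>: "0 \<le> ?\<theta> j" for j
    using OPT_bounds(1)[OF N_nonempty] eta budget_pos by simp
  have Ts: "set ?Ts = (\<Union>j<guesses \<eta> (card N). set (candidates c B (fold (step \<eta> c B f) \<pi>s (?s j))))"
    by (auto simp: start_def)
  have wf: "wf_state (fold (step \<eta> c B f) \<pi>s (?s j))" for j
    using fold_step_facts[OF good_candidate(1)[OF assms(2) \<theta> assms(3,1)] assms(1) \<theta>]
    by (metis prod_cases3)
  obtain T where "T \<in> set (candidates c B (fold (step \<eta> c B f) \<pi>s (?s 0)))"
    using candidates_facts(1)[OF wf, of 0] last_in_set by blast
  hence "T \<in> set ?Ts"
    unfolding Ts by (intro UN_I[of 0]) (simp_all only: guesses_def lessThan_iff zero_less_Suc)
  hence ne: "?Ts \<noteq> []" by (metis empty_iff list.set(1))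
  have "S \<in> set ?Ts" unfolding S_def by (rule best_maximal(1)[OF ne])
  thus "feasible N c B S" using candidates_facts(3)[OF wf] unfolding Ts by blast
  assume j: "j < guesses \<eta> (card N)" "\<theta> = ?\<theta> j"
  obtain T where T: "T \<in> set (candidates c B (fold (step \<eta> c B f) \<pi>s (?s j)))"
    "min (OPT N c B f - ?\<theta> j * B) (?\<theta> j * (1 - \<eta>) * B / 2)
        - ?\<theta> j * total_loss \<eta> c B f \<pi>s (?s j) / 2 \<le> f T"
    using good_candidate(2)[OF assms(2) \<theta> assms(3,1)] by blast
  have "T \<in> set ?Ts" unfolding Ts using T(1) j(1) by blast
  hence "f T \<le> f S" unfolding S_def by (rule best_maximal(2)[OF ne])
  thus "min (OPT N c B f - \<theta> * B) (\<theta> * (1 - \<eta>) * B / 2)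
        - \<theta> * total_loss \<eta> c B f \<pi>s (\<theta>, cheap, N - cheap) / 2 \<le> f S"
    using T(2) unfolding j(2) by linarith
qed

text \<open>The guess \<open>j\<close> depends on the instance and not on the permutations, so the
  best candidate is in expectation at least as good as the one for \<open>j\<close>. The expected
  loss is at most \<open>4 * \<eta> * B\<close>, because a solution never costs more than
  \<open>2 * B\<close>.\<close>

lemma expected_best:
  assumes "2 \<le> card N" "\<eta> \<le> 1 / 24"
  defines "P \<equiv> replicate_pmf (iterations \<eta> (card N)) (pmf_of_set (permutations_of_set N))"
    and "out \<equiv> \<lambda>\<pi>s. best f (concat (map (candidates c B \<circ> fold (step \<eta> c B f) \<pi>s) (start \<eta> N c B f)))"
  shows "OPT N c B f * (1 - 6 * \<eta>) / 3 \<le> measure_pmf.expectation P (\<lambda>\<pi>s. f (out \<pi>s))"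
proof -
  let ?E = "measure_pmf.expectation P :: _ \<Rightarrow> real"
  define M where "M = Max ((\<lambda>x. f {x}) ` N)"
  obtain j where j: "j < guesses \<eta> (card N)" "M * (1 + \<eta>) ^ j \<le> OPT N c B f"
    "OPT N c B f \<le> (1 + \<eta>) * (M * (1 + \<eta>) ^ j)"
    using guess_exists unfolding M_def by blast
  define v where "v = M * (1 + \<eta>) ^ j"
  define \<theta> where "\<theta> = 2 / 3 * v / B"
  define s where "s = (\<theta>, cheap, N - cheap)"
  define m where "m = min (OPT N c B f - \<theta> * B) (\<theta> * (1 - \<eta>) * B / 2)"
  let ?loss = "\<lambda>\<pi>s. total_loss \<eta> c B f \<pi>s s"
  have "0 \<le> M" using OPT_bounds(1)[OF N_nonempty] by (simp add: M_def)
  hence v: "0 \<le> v" "v \<le> OPT N c B f" "OPT N c B f \<le> (1 + \<eta>) * v"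
    using j eta by (auto simp: v_def)
  have \<theta>: "0 \<le> \<theta>" "\<theta> * B = 2 / 3 * v" using v budget_pos by (auto simp: \<theta>_def)
  have set_p: "set_pmf (pmf_of_set (permutations_of_set N)) = permutations_of_set N"
    using fin by (intro set_pmf_of_set) auto
  have set_P: "\<pi>s \<in> set_pmf P \<longleftrightarrow> set \<pi>s \<subseteq> permutations_of_set N \<and> length \<pi>s = iterations \<eta> (card N)"
    for \<pi>s unfolding P_def set_replicate_pmf set_p by auto
  have finP: "finite (set_pmf P)"
  proof (rule finite_subset)
    show "set_pmf P \<subseteq> {\<pi>s. set \<pi>s \<subseteq> permutations_of_set N \<and> length \<pi>s = iterations \<eta> (card N)}"
      using set_P by blast
  qed (simp add: finite_lists_length_eq)
  have integ: "integrable (measure_pmf P) (h :: _ \<Rightarrow> real)" for h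
    using finP by (rule integrable_measure_pmf_finite)
  have cost: "sum c (fst (snd (fold (step \<eta> c B f) \<pi>s s))) - sum c cheap \<le> 2 * B"
    if "\<pi>s \<in> set_pmf P" for \<pi>s
    using good_candidate(3)[of \<theta> \<pi>s] that assms(1) \<theta> cost_nonneg[of cheap]
    unfolding set_P s_def by (auto simp: cheap_def)
  obtain \<pi>s0 where "\<pi>s0 \<in> set_pmf P" using set_pmf_not_empty[of P] by blast
  hence wf: "wf_state s"
    using good_candidate(1)[of \<theta> \<pi>s0] assms(1) \<theta> unfolding set_P s_def by auto
  have "?E ?loss \<le> ?E (\<lambda>\<pi>s. 2 * \<eta> * (sum c (fst (snd (fold (step \<eta> c B f) \<pi>s s))) - sum c cheap))"
    unfolding P_def s_def using wf \<theta>(1) unfolding s_def by (rule expectation_total_loss)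
  also have "\<dots> \<le> ?E (\<lambda>_. 2 * \<eta> * (2 * B))"
    using cost eta by (intro expectation_mono_finite[OF finP] mult_left_mono) auto
  finally have "?E ?loss \<le> 4 * \<eta> * B" by simp
  hence "\<theta> * ?E ?loss \<le> \<theta> * (4 * \<eta> * B)" using \<theta>(1) by (rule mult_left_mono)
  also have "\<dots> = 8 / 3 * \<eta> * v" using \<theta>(2) by (simp add: mult_ac)
  finally have loss: "\<theta> * ?E ?loss / 2 \<le> 4 / 3 * \<eta> * v" by simp
  have "m - \<theta> * ?E ?loss / 2 = ?E (\<lambda>\<pi>s. m - \<theta> * ?loss \<pi>s / 2)"
    using integ by simp
  also have "\<dots> \<le> ?E (\<lambda>\<pi>s. f (out \<pi>s))"
  proof (rule expectation_mono_finite[OF finP])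
    fix \<pi>s assume "\<pi>s \<in> set_pmf P"
    thus "m - \<theta> * ?loss \<pi>s / 2 \<le> f (out \<pi>s)"
      unfolding out_def m_def s_def using assms(1) j(1)
      by (intro best_candidate(2)[of \<pi>s j]) (auto simp: set_P \<theta>_def v_def M_def)
  qed
  finally have "m - 4 / 3 * \<eta> * v \<le> ?E (\<lambda>\<pi>s. f (out \<pi>s))" using loss by linarith
  \<comment> \<open>The second entry of \<open>m\<close> decides: it leaves
    \<open>v * (1 - 5 * \<eta>) / 3\<close>, and passing from \<open>v\<close> to the optimum costs
    one more \<eta>.\<close>
  moreover have "OPT N c B f * (1 - 6 * \<eta>) / 3 \<le> m - 4 / 3 * \<eta> * v"
  proof -
    have "\<eta> * v \<le> \<eta> * OPT N c B f" using v eta by (intro mult_left_mono) auto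
    moreover have "0 \<le> \<eta> * OPT N c B f" using v eta by auto
    moreover have "OPT N c B f * (1 - 6 * \<eta>) / 3 = OPT N c B f / 3 - 2 * (\<eta> * OPT N c B f)"
      by (simp add: field_simps)
    ultimately have 1: "OPT N c B f * (1 - 6 * \<eta>) / 3 \<le> OPT N c B f - \<theta> * B - 4 / 3 * (\<eta> * v)"
      using v(2) unfolding \<theta>(2) by linarith
    have "OPT N c B f * (1 - 6 * \<eta>) \<le> (1 + \<eta>) * v * (1 - 6 * \<eta>)"
      using v(3) assms(2) by (intro mult_right_mono) auto
    also have "\<dots> = v * ((1 + \<eta>) * (1 - 6 * \<eta>))" by simp
    also have "\<dots> \<le> v * (1 - 5 * \<eta>)"
      using v(1) eta by (intro mult_left_mono) (auto simp: algebra_simps)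
    finally have "OPT N c B f * (1 - 6 * \<eta>) / 3 \<le> v * (1 - 5 * \<eta>) / 3" by simp
    also have "\<dots> = 2 / 3 * v * (1 - \<eta>) / 2 - 4 / 3 * \<eta> * v" by (simp add: field_simps)
    also have "2 / 3 * v * (1 - \<eta>) / 2 = \<theta> * (1 - \<eta>) * B / 2"
      unfolding \<theta>(2)[symmetric] by simp
    finally show ?thesis using 1 unfolding m_def mult.assoc by linarith
  qed
  ultimately show ?thesis by linarith
qed

end

lemma parallel_knapsack_run:
  assumes inst: "knapsack_instance N c B f" and \<eta>: "0 < \<eta>" "\<eta> \<le> 1 / 24"
  shows "(\<forall>(S, tr)\<in>set_pmf (run f (parallel_knapsack \<eta> N c B)). feasible N c B S \<and>
      length tr \<le> round_bound \<eta> (card N) \<and> length (concat tr) \<le> total_query_bound \<eta> (card N) \<and>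
      (\<forall>qs\<in>set tr. \<forall>T\<in>set qs. T \<subseteq> N))"
    and "OPT N c B f * (1 - 6 * \<eta>) / 3 \<le>
      measure_pmf.expectation (run f (parallel_knapsack \<eta> N c B)) (\<lambda>(S, tr). f S)"
proof -
  interpret knapsack N c B f using inst by unfold_locales
  have "(\<forall>(S, tr)\<in>set_pmf (run f (parallel_knapsack \<eta> N c B)). feasible N c B S \<and>
      length tr \<le> round_bound \<eta> (card N) \<and> length (concat tr) \<le> total_query_bound \<eta> (card N) \<and>
      (\<forall>qs\<in>set tr. \<forall>T\<in>set qs. T \<subseteq> N)) \<and> OPT N c B f * (1 - 6 * \<eta>) / 3 \<le>
      measure_pmf.expectation (run f (parallel_knapsack \<eta> N c B)) (\<lambda>(S, tr). f S)"
  proof (cases "card N \<le> 1")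
    case True
    have "sum c N \<le> B"
    proof (cases "N = {}")
      case False
      hence "card N = 1" using True fin by (simp add: le_Suc_eq card_eq_0_iff)
      then obtain x where "N = {x}" by (rule card_1_singletonE)
      thus ?thesis using cost_le by simp
    qed (use budget_pos in simp)
    hence feas: "feasible N c B N" by (simp add: feasible_def)
    obtain T where T: "feasible N c B T" "f T = OPT N c B f" by (rule OPT_attained)
    have "OPT N c B f \<le> f N" using T mono[of T N] by (simp add: feasible_def)
    moreover have "0 \<le> OPT N c B f" using T nonneg[of T] by (simp add: feasible_def)
    moreover have "0 \<le> \<eta> * OPT N c B f" using \<eta> calculation(2) by simp
    ultimately have "OPT N c B f * (1 - 6 * \<eta>) / 3 \<le> f N" by (simp add: algebra_simps)
    thus ?thesis using True feas by (simp add: parallel_knapsack_def)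
  next
    case False
    interpret threshold_search N c B f \<eta>
      using \<eta> False by unfold_locales auto
    have n: "2 \<le> card N" using False by simp
    let ?P = "replicate_pmf (iterations \<eta> (card N)) (pmf_of_set (permutations_of_set N))"
    let ?out = "\<lambda>\<pi>s. best f (concat (map (candidates c B \<circ> fold (step \<eta> c B f) \<pi>s) (start \<eta> N c B f)))"
    have "set_pmf (pmf_of_set (permutations_of_set N)) = permutations_of_set N"
      using fin by (intro set_pmf_of_set) auto
    hence set_P: "set \<pi>s \<subseteq> permutations_of_set N" "length \<pi>s = iterations \<eta> (card N)"
      if "\<pi>s \<in> set_pmf ?P" for \<pi>s
      using that unfolding set_replicate_pmf by auto
    have "\<exists>tr. \<forall>\<pi>s\<in>set_pmf ?P. run f (search \<eta> N c B \<pi>s) = return_pmf (?out \<pi>s, tr \<pi>s) \<and>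
      length (tr \<pi>s) = round_bound \<eta> (card N) \<and>
      length (concat (tr \<pi>s)) \<le> total_query_bound \<eta> (card N) \<and>
      (\<forall>qs\<in>set (tr \<pi>s). \<forall>T\<in>set qs. T \<subseteq> N)"
      using run_search[OF set_P(1) n set_P(2)] by (intro bchoice) blast
    then obtain tr where tr: "\<forall>\<pi>s\<in>set_pmf ?P. run f (search \<eta> N c B \<pi>s) = return_pmf (?out \<pi>s, tr \<pi>s) \<and>
      length (tr \<pi>s) = round_bound \<eta> (card N) \<and>
      length (concat (tr \<pi>s)) \<le> total_query_bound \<eta> (card N) \<and>
      (\<forall>qs\<in>set (tr \<pi>s). \<forall>T\<in>set qs. T \<subseteq> N)" by blast
    have "run f (parallel_knapsack \<eta> N c B) = ?P \<bind> (\<lambda>\<pi>s. run f (search \<eta> N c B \<pi>s))"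
      using False by (simp add: parallel_knapsack_def bind_eq_join_pmf map_pmf_comp)
    also have "\<dots> = ?P \<bind> (\<lambda>\<pi>s. return_pmf (?out \<pi>s, tr \<pi>s))"
      using tr by (intro bind_pmf_cong) auto
    also have "\<dots> = map_pmf (\<lambda>\<pi>s. (?out \<pi>s, tr \<pi>s)) ?P" by (simp add: map_pmf_def)
    finally have run: "run f (parallel_knapsack \<eta> N c B) = \<dots>" .
    have "feasible N c B (?out \<pi>s)" if "\<pi>s \<in> set_pmf ?P" for \<pi>s
      using set_P[OF that] n by (intro best_candidate(1))
    thus ?thesis unfolding run using tr expected_best[OF n \<eta>(2)] by auto
  qed
  thus "(\<forall>(S, tr)\<in>set_pmf (run f (parallel_knapsack \<eta> N c B)). feasible N c B S \<and>
      length tr \<le> round_bound \<eta> (card N) \<and> length (concat tr) \<le> total_query_bound \<eta> (card N) \<and>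
      (\<forall>qs\<in>set tr. \<forall>T\<in>set qs. T \<subseteq> N))"
    "OPT N c B f * (1 - 6 * \<eta>) / 3 \<le>
      measure_pmf.expectation (run f (parallel_knapsack \<eta> N c B)) (\<lambda>(S, tr). f S)" by auto
qed

lemma parallel_knapsack_correct:
  assumes "0 < \<epsilon>" "\<epsilon> < 1"
  shows "queries_subsets_only (parallel_knapsack (\<epsilon> / 24) :: 'a knapsack_alg)"
    and "approximation_alg (3 + \<epsilon>) (parallel_knapsack (\<epsilon> / 24) :: 'a knapsack_alg)"
    and "adaptivity_bound (parallel_knapsack (\<epsilon> / 24) :: 'a knapsack_alg) (\<lambda>n. real (round_bound (\<epsilon> / 24) n))"
    and "query_bound (parallel_knapsack (\<epsilon> / 24) :: 'a knapsack_alg) (\<lambda>n. real (total_query_bound (\<epsilon> / 24) n))"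
proof -
  have \<eta>: "0 < \<epsilon> / 24" "\<epsilon> / 24 \<le> 1 / 24" using assms by auto
  note run = parallel_knapsack_run[OF _ \<eta>]
  show "queries_subsets_only (parallel_knapsack (\<epsilon> / 24) :: 'a knapsack_alg)"
    unfolding queries_subsets_only_def using run(1) by fast
  show "adaptivity_bound (parallel_knapsack (\<epsilon> / 24) :: 'a knapsack_alg) (\<lambda>n. real (round_bound (\<epsilon> / 24) n))"
    unfolding adaptivity_bound_def of_nat_le_iff using run(1) by fast
  show "query_bound (parallel_knapsack (\<epsilon> / 24) :: 'a knapsack_alg) (\<lambda>n. real (total_query_bound (\<epsilon> / 24) n))"
    unfolding query_bound_def of_nat_le_iff using run(1) by fast
  have approx: "OPT N c B f \<le> (3 + \<epsilon>) *
      measure_pmf.expectation (run f (parallel_knapsack (\<epsilon> / 24) N c B)) (\<lambda>(S, tr). f S)"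
    if inst: "knapsack_instance N c B f" for N :: "'a set" and c B f
  proof -
    interpret knapsack N c B f using inst by unfold_locales
    obtain T where T: "feasible N c B T" "f T = OPT N c B f" by (rule OPT_attained)
    have OPT: "0 \<le> OPT N c B f" using T nonneg[of T] by (simp add: feasible_def)
    \<comment> \<open>With \<open>\<eta> = \<epsilon> / 24\<close> the factor times the guaranteed
      fraction is \<open>1 + (\<epsilon> - \<epsilon> * \<epsilon>) / 12\<close>.\<close>
    have "\<epsilon> * \<epsilon> \<le> \<epsilon>" using assms by (simp add: mult_le_cancel_left1)
    hence "1 \<le> (3 + \<epsilon>) * ((1 - 6 * (\<epsilon> / 24)) / 3)" by (simp add: field_simps)
    hence "OPT N c B f * 1 \<le> OPT N c B f * ((3 + \<epsilon>) * ((1 - 6 * (\<epsilon> / 24)) / 3))"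
      using OPT by (rule mult_left_mono)
    also have "\<dots> = (3 + \<epsilon>) * (OPT N c B f * (1 - 6 * (\<epsilon> / 24)) / 3)" by simp
    also have "\<dots> \<le> (3 + \<epsilon>) *
        measure_pmf.expectation (run f (parallel_knapsack (\<epsilon> / 24) N c B)) (\<lambda>(S, tr). f S)"
      using run(2)[OF inst] assms by (intro mult_left_mono) auto
    finally show ?thesis by simp
  qed
  show "approximation_alg (3 + \<epsilon>) (parallel_knapsack (\<epsilon> / 24) :: 'a knapsack_alg)"
    unfolding approximation_alg_def
  proof (intro allI impI conjI)
    fix N :: "'a set" and c B f assume inst: "knapsack_instance N c B f"
    show "\<forall>(S, tr)\<in>set_pmf (run f (parallel_knapsack (\<epsilon> / 24) N c B)). feasible N c B S"
      using run(1)[OF inst] by fast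
    show "OPT N c B f \<le> (3 + \<epsilon>) *
        measure_pmf.expectation (run f (parallel_knapsack (\<epsilon> / 24) N c B)) (\<lambda>(S, tr). f S)"
      by (rule approx[OF inst])
  qed
qed

section \<open>Asymptotic size of the parameters\<close>

lemma parameter_bounds:
  assumes "0 < \<epsilon>" "\<epsilon> < 1" "2 \<le> n"
  defines "t \<equiv> ln (real n) / \<epsilon>"
  shows "1 / 2 \<le> t" "real (iterations (\<epsilon> / 24) n) \<le> 150 * t" "real (guesses (\<epsilon> / 24) n) \<le> 150 * t"
    "real (probe_bound (\<epsilon> / 24) n) \<le> 150 * t"
proof -
  define \<eta> where "\<eta> = \<epsilon> / 24"
  have \<eta>: "0 < \<eta>" "\<eta> \<le> 1 / 2" "\<epsilon> = 24 * \<eta>" using assms by (auto simp: \<eta>_def)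
  \<comment> \<open>A positive lower bound on \<open>t\<close> lets multiples of \<open>t\<close>
    absorb additive constants.\<close>
  have "1 / 2 \<le> ln (2 :: real)" using ln2_ge_two_thirds by simp
  also have "\<dots> \<le> ln n" using assms by simp
  finally have ln_n: "1 / 2 \<le> ln (real n)" .
  also have "ln (real n) * 1 \<le> ln (real n) * (1 / \<epsilon>)" using assms ln_n by (intro mult_left_mono) auto
  finally show t: "1 / 2 \<le> t" by (simp add: t_def)
  have inv: "1 / \<eta> \<le> 48 * t"
    using mult_right_mono[OF ln_n, of "1 / \<epsilon>"] assms by (simp add: t_def \<eta>_def field_simps)
  have "\<eta> - \<eta>\<^sup>2 \<le> ln (1 + \<eta>)" using \<eta> by (intro ln_one_plus_pos_lower_bound) auto
  moreover have "\<eta>\<^sup>2 \<le> \<eta> / 2" using \<eta> by (simp add: power2_eq_square)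
  ultimately have ln_\<eta>: "\<eta> / 2 \<le> ln (1 + \<eta>)" by linarith
  \<comment> \<open>A logarithm to base \<open>1 + \<eta>\<close> is at most
    \<open>2 / \<eta> = 48 / \<epsilon>\<close> times the natural one.\<close>
  have log_le: "log (1 + \<eta>) x \<le> 48 * k * t" if "1 \<le> x" "ln x \<le> k * ln n" for x k
  proof -
    have "log (1 + \<eta>) x = ln x / ln (1 + \<eta>)" by (simp add: log_def)
    also have "\<dots> \<le> ln x / (\<eta> / 2)" using ln_\<eta> \<eta> that by (intro divide_left_mono) auto
    also have "\<dots> \<le> (k * ln n) / (\<eta> / 2)" using that \<eta> by (intro divide_right_mono) auto
    finally show ?thesis by (simp add: t_def \<eta>_def mult_ac)
  qed
  \<comment> \<open>In this case \<open>n\<close> itself is of order \<open>1 / \<epsilon>\<close>,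
    which settles \<open>iterations\<close> and \<open>probe_bound\<close>.\<close>
  have small: "real n \<le> 48 * t" if "\<eta> * n < 1"
  proof -
    have "real n \<le> 1 / \<eta>" using that \<eta> by (simp add: field_simps)
    thus ?thesis using inv by linarith
  qed
  have "real (iterations \<eta> n) \<le> 150 * t"
  proof (cases "\<eta> * n < 1")
    case False
    have "0 \<le> 3 * ln n / \<eta>" using \<eta> ln_n by simp
    hence "real (iterations \<eta> n) \<le> 3 * ln n / \<eta> + 2"
      using False by (simp add: iterations_def) linarith
    also have "3 * ln n / \<eta> = 72 * t" by (simp add: t_def \<eta>_def)
    finally show ?thesis using t by linarith
  qed (use small t in \<open>simp add: iterations_def\<close>)
  thus "real (iterations (\<epsilon> / 24) n) \<le> 150 * t" by (simp add: \<eta>_def)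
  have "0 \<le> log (1 + \<eta>) n" using \<eta> assms by simp
  hence "real (guesses \<eta> n) \<le> log (1 + \<eta>) n + 1" unfolding guesses_def by linarith
  also have "\<dots> \<le> 48 * 1 * t + 1" using assms by (intro add_right_mono log_le) auto
  finally show "real (guesses (\<epsilon> / 24) n) \<le> 150 * t" using t by (simp add: \<eta>_def)
  have "real (probe_bound \<eta> n) \<le> 150 * t"
  proof (cases "\<eta> * n < 1")
    case True
    have "real (probe_bound \<eta> n) \<le> real n + 1" by (simp add: probe_bound_def)
    thus ?thesis using small[OF True] t by linarith
  next
    case False
    have pos: "0 < real n" using assms by simp
    have x: "1 \<le> real n ^ 2 / \<eta>"
    proof -
      have "\<eta> \<le> 1" "1 \<le> real n ^ 2" using \<eta> assms by auto
      thus ?thesis using \<eta> by (simp add: field_simps)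
    qed
    have "real n ^ 2 / \<eta> \<le> real n ^ 3"
      using False \<eta> pos mult_left_mono[of 1 "\<eta> * n" "real n ^ 2"]
      by (simp add: field_simps power2_eq_square power3_eq_cube)
    hence "ln (real n ^ 2 / \<eta>) \<le> ln (real n ^ 3)" using x pos by (subst ln_le_cancel_iff) auto
    also have "\<dots> = 3 * ln n" using pos by (simp add: ln_realpow)
    finally have "log (1 + \<eta>) (real n ^ 2 / \<eta>) \<le> 48 * 3 * t" using x by (intro log_le) auto
    moreover have "0 \<le> log (1 + \<eta>) (real n ^ 2 / \<eta>)"
      using \<eta>(1) x by (subst zero_le_log_cancel_iff) linarith+
    ultimately have "real (Suc (Suc (nat \<lfloor>log (1 + \<eta>) (real n ^ 2 / \<eta>)\<rfloor>))) \<le> 48 * 3 * t + 2"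
      by linarith
    hence "real (probe_bound \<eta> n) \<le> 48 * 3 * t + 2" unfolding probe_bound_def by linarith
    thus ?thesis using t by linarith
  qed
  thus "real (probe_bound (\<epsilon> / 24) n) \<le> 150 * t" by (simp add: \<eta>_def)
qed

lemma round_bound_le:
  assumes "0 < \<epsilon>" "\<epsilon> < 1" "1 \<le> n"
  shows "real (round_bound (\<epsilon> / 24) n) \<le> 200 * (1 / \<epsilon> * ln (real n))"
proof (cases "n = 1")
  case False
  hence "2 \<le> n" using assms by simp
  from parameter_bounds[OF assms(1,2) this] show ?thesis
    using \<open>2 \<le> n\<close> by (simp add: round_bound_def)
qed (simp add: round_bound_def)

text \<open>Iterations, guesses and probes contribute one factor of order
  \<open>t = ln n / \<epsilon>\<close> each, and a probe takes \<open>n + 1\<close> queries. The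
  lower-order terms \<open>n\<close> and \<open>t\<close> are within constant factors of
  \<open>n * t ^ 3\<close> because \<open>t \<ge> 1 / 2\<close>.\<close>

lemma total_query_bound_le:
  assumes "0 < \<epsilon>" "\<epsilon> < 1" "1 \<le> n"
  shows "real (total_query_bound (\<epsilon> / 24) n) \<le> 10000000 * (real n / \<epsilon> ^ 3 * ln (real n) ^ 3)"
proof (cases "n = 1")
  case False
  hence n: "2 \<le> n" using assms by simp
  define t where "t = ln (real n) / \<epsilon>"
  note b = parameter_bounds[OF assms(1,2) n, folded t_def]
  have t3: "1 / 8 \<le> t ^ 3" using power_mono[OF b(1), of 3] by (simp add: power_divide)
  have "t * (1 / 2) ^ 2 \<le> t * t ^ 2" using b(1) by (intro mult_left_mono power_mono) auto
  hence t1: "t \<le> 4 * t ^ 3" by (simp add: power2_eq_square power3_eq_cube)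
  have "real (iterations (\<epsilon> / 24) n) * (real (guesses (\<epsilon> / 24) n) *
      (real (probe_bound (\<epsilon> / 24) n) * real (Suc n))) \<le> (150 * t) * ((150 * t) * ((150 * t) * (2 * n)))"
    using b n by (intro mult_mono) auto
  also have "\<dots> = 6750000 * (n * t ^ 3)" by (simp add: power3_eq_cube)
  finally have main: "real (iterations (\<epsilon> / 24) n) * (real (guesses (\<epsilon> / 24) n) *
      (real (probe_bound (\<epsilon> / 24) n) * real (Suc n))) \<le> \<dots>" .
  have "real n * (1 / 8) \<le> real n * t ^ 3" using t3 by (intro mult_left_mono) auto
  moreover have "1 * t ^ 3 \<le> real n * t ^ 3" using t3 n by (intro mult_right_mono) linarith+
  moreover have "real (total_query_bound (\<epsilon> / 24) n) = real n +
      real (iterations (\<epsilon> / 24) n) * (real (guesses (\<epsilon> / 24) n) *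
      (real (probe_bound (\<epsilon> / 24) n) * real (Suc n))) + real (guesses (\<epsilon> / 24) n) * 2"
    using n by (simp add: total_query_bound_def distrib_left)
  ultimately have "real (total_query_bound (\<epsilon> / 24) n) \<le> 10000000 * (real n * t ^ 3)"
    using main b(3) t1 by linarith
  also have "real n * t ^ 3 = real n / \<epsilon> ^ 3 * ln (real n) ^ 3" by (simp add: t_def power_divide)
  finally show ?thesis .
qed (simp add: total_query_bound_def)

text \<open>Lets the round bound of order \<open>ln n / \<epsilon>\<close> serve for the weaker
  claim with \<open>ln n ^ 2\<close>. For \<open>n \<ge> 2\<close> the constant comes from
  \<open>ln n \<ge> 1 / 2\<close>.\<close>

lemma ln_le_twice_ln_squared:
  assumes "1 \<le> n"
  shows "ln (real n) \<le> 2 * ln (real n) ^ 2"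
proof (cases "n = 1")
  case False
  have "1 / 2 \<le> ln (2 :: real)" using ln2_ge_two_thirds by simp
  also have "\<dots> \<le> ln n" using assms False by simp
  finally have "ln n * (1 / 2) \<le> ln n * ln (real n)" by (intro mult_left_mono) auto
  thus ?thesis by (simp add: power2_eq_square)
qed simp

theorem theorem3:
  "(\<exists>(A :: real \<Rightarrow> 'a knapsack_alg) (R :: real \<Rightarrow> nat \<Rightarrow> real) (Q :: real \<Rightarrow> nat \<Rightarrow> real).
      (\<forall>\<epsilon>\<in>{0<..<1}.
         queries_subsets_only (A \<epsilon>) \<and> approximation_alg (3 + \<epsilon>) (A \<epsilon>) \<and>
         adaptivity_bound (A \<epsilon>) (R \<epsilon>) \<and> query_bound (A \<epsilon>) (Q \<epsilon>)) \<and>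
      (\<lambda>(\<epsilon>, n). R \<epsilon> n) \<in> O[principal ({0<..<1} \<times> {1..})](\<lambda>(\<epsilon>, n). 1 / \<epsilon> * ln (real n)) \<and>
      (\<forall>\<delta>\<in>{0<..<1}.
         (\<lambda>(\<epsilon>, n). Q \<epsilon> n) \<in> O[principal ({0<..\<delta>} \<times> {1..})](
           \<lambda>(\<epsilon>, n). real n ^ 2 / \<epsilon> ^ 3 * ln (real n) ^ 2 * ln (1 / \<epsilon>)))) \<and>
   (\<exists>(A :: real \<Rightarrow> 'a knapsack_alg) (R :: real \<Rightarrow> nat \<Rightarrow> real) (Q :: real \<Rightarrow> nat \<Rightarrow> real).
      (\<forall>\<epsilon>\<in>{0<..<1}.
         queries_subsets_only (A \<epsilon>) \<and> approximation_alg (3 + \<epsilon>) (A \<epsilon>) \<and>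
         adaptivity_bound (A \<epsilon>) (R \<epsilon>) \<and> query_bound (A \<epsilon>) (Q \<epsilon>)) \<and>
      (\<lambda>(\<epsilon>, n). R \<epsilon> n) \<in> O[principal ({0<..<1} \<times> {1..})](\<lambda>(\<epsilon>, n). 1 / \<epsilon> * ln (real n) ^ 2) \<and>
      (\<forall>\<delta>\<in>{0<..<1}.
         (\<lambda>(\<epsilon>, n). Q \<epsilon> n) \<in> O[principal ({0<..\<delta>} \<times> {1..})](
           \<lambda>(\<epsilon>, n). real n / \<epsilon> ^ 3 * ln (real n) ^ 3 * ln (1 / \<epsilon>))))"
proof -
  define A where "A = (\<lambda>\<epsilon>. parallel_knapsack (\<epsilon> / 24) :: 'a knapsack_alg)"
  define R where "R = (\<lambda>\<epsilon> n. real (round_bound (\<epsilon> / 24) n))"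
  define Q where "Q = (\<lambda>\<epsilon> n. real (total_query_bound (\<epsilon> / 24) n))"
  have alg: "\<forall>\<epsilon>\<in>{0<..<1}. queries_subsets_only (A \<epsilon>) \<and> approximation_alg (3 + \<epsilon>) (A \<epsilon>) \<and>
      adaptivity_bound (A \<epsilon>) (R \<epsilon>) \<and> query_bound (A \<epsilon>) (Q \<epsilon>)"
    using parallel_knapsack_correct unfolding A_def R_def Q_def by auto
  \<comment> \<open>For a principal filter one constant must work at every point of the set, so the
    estimate is uniform in \<epsilon> and \<open>n\<close>; at \<open>n = 1\<close> both sides are
    0.\<close>
  have R1: "(\<lambda>(\<epsilon>, n). R \<epsilon> n) \<in> O[principal ({0<..<1} \<times> {1..})](\<lambda>(\<epsilon>, n). 1 / \<epsilon> * ln (real n))"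
    using round_bound_le
    by (intro bigoI[of _ 200]) (auto simp: eventually_principal R_def)
  have R2: "(\<lambda>(\<epsilon>, n). R \<epsilon> n) \<in> O[principal ({0<..<1} \<times> {1..})](\<lambda>(\<epsilon>, n). 1 / \<epsilon> * ln (real n) ^ 2)"
  proof (rule bigoI[of _ 400], unfold eventually_principal, rule ballI)
    fix p assume "p \<in> {0<..<1 :: real} \<times> {1 :: nat ..}"
    then obtain \<epsilon> n where p: "p = (\<epsilon>, n)" "0 < \<epsilon>" "\<epsilon> < 1" "1 \<le> n" by auto
    have "R \<epsilon> n \<le> 200 * (1 / \<epsilon> * ln (real n))"
      using round_bound_le[OF p(2-4)] by (simp add: R_def)
    also have "\<dots> \<le> 200 * (1 / \<epsilon> * (2 * ln (real n) ^ 2))"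
      using ln_le_twice_ln_squared[OF p(4)] p by (intro mult_left_mono) auto
    finally show "norm (case p of (\<epsilon>, n) \<Rightarrow> R \<epsilon> n) \<le>
        400 * norm (case p of (\<epsilon>, n) \<Rightarrow> 1 / \<epsilon> * ln (real n) ^ 2)"
      using p by (simp add: R_def)
  qed
  have Q2: "(\<lambda>(\<epsilon>, n). Q \<epsilon> n) \<in> O[principal ({0<..\<delta>} \<times> {1..})](
      \<lambda>(\<epsilon>, n). real n / \<epsilon> ^ 3 * ln (real n) ^ 3 * ln (1 / \<epsilon>))" if \<delta>: "\<delta> \<in> {0<..<1}" for \<delta> :: real
  \<comment> \<open>The query count obeys the bound without the factor
    \<open>ln (1 / \<epsilon>)\<close>. For \<open>\<epsilon> \<le> \<delta>\<close> this factor is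
    at least \<open>ln (1 / \<delta>) > 0\<close>, which fixes the constant.\<close>
  proof (rule bigoI[of _ "10000000 / ln (1 / \<delta>)"], unfold eventually_principal, rule ballI)
    fix p assume "p \<in> {0<..\<delta>} \<times> {1 :: nat ..}"
    then obtain \<epsilon> n where p: "p = (\<epsilon>, n)" "0 < \<epsilon>" "\<epsilon> \<le> \<delta>" "1 \<le> n" by auto
    let ?b = "real n / \<epsilon> ^ 3 * ln (real n) ^ 3"
    have b: "0 \<le> ?b" using p by simp
    have \<delta>_pos: "0 < ln (1 / \<delta>)" using \<delta> by simp
    have "ln (1 / \<delta>) \<le> ln (1 / \<epsilon>)" using p \<delta> by (simp add: frac_le)
    hence ratio: "1 \<le> ln (1 / \<epsilon>) / ln (1 / \<delta>)" using \<delta>_pos by simp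
    have "Q \<epsilon> n \<le> 10000000 * ?b * 1"
      using total_query_bound_le[of \<epsilon> n] p \<delta> by (simp add: Q_def)
    also have "\<dots> \<le> 10000000 * ?b * (ln (1 / \<epsilon>) / ln (1 / \<delta>))"
      using ratio b by (intro mult_left_mono) auto
    also have "\<dots> = 10000000 / ln (1 / \<delta>) * (?b * ln (1 / \<epsilon>))" by (simp add: mult_ac)
    finally have "Q \<epsilon> n \<le> \<dots>" .
    moreover have "0 \<le> ?b * ln (1 / \<epsilon>)"
      using b \<open>ln (1 / \<delta>) \<le> _\<close> \<delta>_pos by (intro mult_nonneg_nonneg[OF b]) auto
    ultimately show "norm (case p of (\<epsilon>, n) \<Rightarrow> Q \<epsilon> n) \<le> 10000000 / ln (1 / \<delta>) *
        norm (case p of (\<epsilon>, n) \<Rightarrow> real n / \<epsilon> ^ 3 * ln (real n) ^ 3 * ln (1 / \<epsilon>))"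
      unfolding p(1) prod.case real_norm_def by (simp only: abs_of_nonneg Q_def of_nat_0_le_iff)
  qed
  have Q1: "(\<lambda>(\<epsilon>, n). Q \<epsilon> n) \<in> O[principal ({0<..\<delta>} \<times> {1..})](
      \<lambda>(\<epsilon>, n). real n ^ 2 / \<epsilon> ^ 3 * ln (real n) ^ 2 * ln (1 / \<epsilon>))" if \<delta>: "\<delta> \<in> {0<..<1}" for \<delta> :: real
  \<comment> \<open>One factor \<open>ln n\<close> is traded for \<open>n\<close>, so the second
    query bound implies the first.\<close>
  proof (rule landau_o.big_trans[OF Q2[OF that]], rule bigoI[of _ 1],
      unfold eventually_principal, rule ballI)
    fix p assume "p \<in> {0<..\<delta>} \<times> {1 :: nat ..}"
    then obtain \<epsilon> n where p: "p = (\<epsilon>, n)" "0 < \<epsilon>" "\<epsilon> \<le> \<delta>" "1 \<le> n" by auto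
    have l: "0 \<le> ln (real n)" "ln (real n) \<le> real n" "0 \<le> ln (1 / \<epsilon>)"
      using p \<delta> ln_bound[of "real n"] by auto
    have "real n / \<epsilon> ^ 3 * ln (real n) ^ 3 * ln (1 / \<epsilon>) =
        real n / \<epsilon> ^ 3 * ln (real n) ^ 2 * ln (1 / \<epsilon>) * ln (real n)"
      by (simp add: power2_eq_square power3_eq_cube)
    also have "\<dots> \<le> real n / \<epsilon> ^ 3 * ln (real n) ^ 2 * ln (1 / \<epsilon>) * real n"
      using l p by (intro mult_left_mono) auto
    also have "\<dots> = real n ^ 2 / \<epsilon> ^ 3 * ln (real n) ^ 2 * ln (1 / \<epsilon>)"
      by (simp add: power2_eq_square)
    finally show "norm (case p of (\<epsilon>, n) \<Rightarrow> real n / \<epsilon> ^ 3 * ln (real n) ^ 3 * ln (1 / \<epsilon>)) \<le>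
        1 * norm (case p of (\<epsilon>, n) \<Rightarrow> real n ^ 2 / \<epsilon> ^ 3 * ln (real n) ^ 2 * ln (1 / \<epsilon>))"
      using l p unfolding p(1) by simp
  qed
  show ?thesis using alg R1 R2 Q1 Q2 by blast
qed

end
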